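(* Let $-\infty<s_-<s_+<+\infty$, $\eta_-\in\mathbb R_-\cup\{0,\infty\}$, and $\eta_+\in[n_1,n_2]$. Then: (i) $(-\pi,0)\setminus\{-\pi/2\}\subset\operatorname{dom}\rho_{\min}\subset(-\pi,0)$ and $$\Sigma[\mathbb F]=\{c\,e^{\mathrm i\gamma}\rho_{\min}(\gamma):c\in[1,+\infty),\ \gamma\in\operatorname{dom}\rho_{\min}\}.$$ (ii) The Pareto frontier of minimal decay $\mathfrak P_{\mathrm{Dr}}=\{\alpha-\mathrm i\beta_{\min}(\alpha):\alpha\in\operatorname{dom}\beta_{\min}\}$ is determined by the Pareto frontier of minimal modulus $\mathfrak P_{\mathrm{mod}}=\{e^{\mathrm i\gamma}\rho_{\min}(\gamma):\gamma\in\operatorname{dom}\rho_{\min}\}$ through the formula $$\beta_{\min}(\alpha)=\inf\{\beta\in\mathbb R:\ \alpha-\mathrm i\beta=c\,k\ \text{ for some } c\in[1,+\infty)\text{ and } k\in\mathfrak P_{\mathrm{mod}}\},\qquad \alpha\in\mathbb R.$$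
   Context: Fix constants $0<n_1<n_2$. $\mathbb R_-=(-\infty,0)$; $\operatorname{Arg}_0$ is the principal argument in $(-\pi,\pi]$; $\inf\varnothing=+\infty$; for a function $g$ with values in $(-\infty,+\infty]$, $\operatorname{dom}g=\{t:g(t)<+\infty\}$. $\mathbb F_{s_-,s_+}=\{\varepsilon\in L^\infty((s_-,s_+);\mathbb R):n_1^2\le\varepsilon\le n_2^2\text{ a.e.}\}$. For $\varepsilon\in\mathbb F_{s_-,s_+}$, $\Sigma^{s_-,s_+}_{\eta_-,\eta_+}(\varepsilon)$ is the set of $k\in\mathbb C\setminus\{0\}$ such that $y''=-k^2\varepsilon y$ on $(s_-,s_+)$ has a nontrivial solution with $\frac{y'(s_\pm)}{\mathrm i k\,y(s_\pm)}=\eta_\pm$ (understood as $y(s_\pm)=0$ when $\eta_\pm=\infty$). Put $\Sigma[\mathbb F]=\bigcup_{\varepsilon\in\mathbb F_{s_-,s_+}}\Sigma^{s_-,s_+}_{\eta_-,\eta_+}(\varepsilon)$. $\rho_{\min}(\gamma)=\inf\{|k|:k\in\Sigma[\mathbb F],\ \operatorname{Arg}_0k=\gamma\}$, so $\operatorname{dom}\rho_{\min}$ is the set of achievable arguments $\operatorname{Arg}_0k$, $k\in\Sigma[\mathbb F]$. $\beta_{\min}(\alpha)=\inf\{\beta\in\mathbb R:\alpha-\mathrm i\beta\in\Sigma[\mathbb F]\}$ for $\alpha\in\mathbb R$. *)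

theory Defs
  imports "HOL-Analysis.Analysis"
begin

(* Absolute continuity of a function (not of a measure).  For S an interval, "d division_of T"
   with T \<subseteq> S ranges over the finite families of non-overlapping compact
   subintervals of S; Inf K and Sup K are the endpoints of K. *)
definition abs_cont_on :: "real set \<Rightarrow> (real \<Rightarrow> complex) \<Rightarrow> bool" where
  "abs_cont_on S f \<longleftrightarrow>
     (\<forall>e>0. \<exists>\<delta>>0. \<forall>d T. d division_of T \<and> T \<subseteq> S \<and> (\<Sum>K\<in>d. Sup K - Inf K) < \<delta> \<longrightarrow>
        (\<Sum>K\<in>d. norm (f (Sup K) - f (Inf K))) < e)"

(* Elements of L-infinity are represented by measurable functions on the whole line; values
   outside the interval and on null sets are irrelevant throughout. *)
definition admissible :: "real \<Rightarrow> real \<Rightarrow> real \<Rightarrow> real \<Rightarrow> (real \<Rightarrow> real) set" where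
  "admissible n1 n2 sm sp =
     {\<epsilon>. \<epsilon> \<in> borel_measurable (lebesgue_on {sm<..<sp}) \<and>
         (AE t in lebesgue_on {sm<..<sp}. n1\<^sup>2 \<le> \<epsilon> t \<and> \<epsilon> t \<le> n2\<^sup>2)}"

(* y with derivative z solves y'' = - k^2 \<epsilon> y on (sm, sp).  The coefficient is only
   essentially bounded, so y' is absolutely continuous and the equation holds almost everywhere;
   y and y' are taken up to the boundary (one-sided derivative at the endpoints). *)
definition is_solution ::
  "(real \<Rightarrow> real) \<Rightarrow> complex \<Rightarrow> real \<Rightarrow> real \<Rightarrow> (real \<Rightarrow> complex) \<Rightarrow> (real \<Rightarrow> complex) \<Rightarrow> bool" where
  "is_solution \<epsilon> k sm sp y z \<longleftrightarrow>
     (\<forall>t\<in>{sm..sp}. (y has_vector_derivative z t) (at t within {sm..sp})) \<and>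
     abs_cont_on {sm..sp} z \<and>
     (AE t in lebesgue_on {sm<..<sp}.
        (z has_vector_derivative - k\<^sup>2 * complex_of_real (\<epsilon> t) * y t) (at t))"

(* y'/(i k y) = \<eta> at an endpoint, where u = y and v = y' there.  The extended reals only serve
   to adjoin one point at infinity, hence the absolute value.  For finite \<eta> the
   denominator must be required to be nonzero, since division by zero yields 0. *)
definition boundary_cond :: "ereal \<Rightarrow> complex \<Rightarrow> complex \<Rightarrow> complex \<Rightarrow> bool" where
  "boundary_cond \<eta> k u v \<longleftrightarrow>
     (if \<bar>\<eta>\<bar> = \<infinity> then u = 0
      else u \<noteq> 0 \<and> v / (\<i> * k * u) = complex_of_real (real_of_ereal \<eta>))"

definition resonances ::
  "real \<Rightarrow> real \<Rightarrow> ereal \<Rightarrow> ereal \<Rightarrow> (real \<Rightarrow> real) \<Rightarrow> complex set" where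
  "resonances sm sp \<eta>m \<eta>p \<epsilon> =
     {k. k \<noteq> 0 \<and>
        (\<exists>y z. is_solution \<epsilon> k sm sp y z \<and> (\<exists>t\<in>{sm<..<sp}. y t \<noteq> 0) \<and>
               boundary_cond \<eta>m k (y sm) (z sm) \<and> boundary_cond \<eta>p k (y sp) (z sp))}"

definition achievable ::
  "real \<Rightarrow> real \<Rightarrow> real \<Rightarrow> real \<Rightarrow> ereal \<Rightarrow> ereal \<Rightarrow> complex set" where
  "achievable n1 n2 sm sp \<eta>m \<eta>p =
     (\<Union>\<epsilon>\<in>admissible n1 n2 sm sp. resonances sm sp \<eta>m \<eta>p \<epsilon>)"

definition edom :: "(real \<Rightarrow> ereal) \<Rightarrow> real set" where
  "edom g = {t. g t < \<infinity>}"

definition rho_min :: "complex set \<Rightarrow> real \<Rightarrow> ereal" where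
  "rho_min S \<gamma> = Inf {ereal (norm k) | k. k \<in> S \<and> Arg k = \<gamma>}"

definition beta_min :: "complex set \<Rightarrow> real \<Rightarrow> ereal" where
  "beta_min S \<alpha> = Inf {ereal \<beta> | \<beta>. complex_of_real \<alpha> - \<i> * complex_of_real \<beta> \<in> S}"

definition pareto_mod :: "complex set \<Rightarrow> complex set" where
  "pareto_mod S = {cis \<gamma> * complex_of_real (real_of_ereal (rho_min S \<gamma>)) | \<gamma>. \<gamma> \<in> edom (rho_min S)}"

definition decay_graph :: "(real \<Rightarrow> ereal) \<Rightarrow> complex set" where
  "decay_graph g =
     {complex_of_real \<alpha> - \<i> * complex_of_real (real_of_ereal (g \<alpha>)) | \<alpha>. \<alpha> \<in> edom g}"

definition pareto_Dr :: "complex set \<Rightarrow> complex set" where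
  "pareto_Dr S = decay_graph (beta_min S)"

definition decay_from_frontier :: "complex set \<Rightarrow> real \<Rightarrow> ereal" where
  "decay_from_frontier P \<alpha> =
     Inf {ereal \<beta> | \<beta>. \<exists>c\<ge>1. \<exists>k\<in>P.
            complex_of_real \<alpha> - \<i> * complex_of_real \<beta> = complex_of_real c * k}"

end

theory Submission
  imports Defs "HOL-Complex_Analysis.Great_Picard"
begin

text \<open>
  Put \<open>w = y' / (\<i> k)\<close>.  Then \<open>y'' = - k\<^sup>2 \<epsilon> y\<close> becomes the system \<open>y' = \<i> k w\<close>, \<open>w' = \<i> k \<epsilon> y\<close>, and
  the boundary conditions say that \<open>(y, w)\<close> starts on the complex line \<open>w = \<eta>\<^sub>- y\<close> and ends on
  the line \<open>w = \<eta>\<^sub>+ y\<close>.  After rescaling time, \<open>k = c \<kappa>\<close> with \<open>\<kappa>\<close> on the unit circle is a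
  resonance for some \<open>\<epsilon>\<close> exactly if the control system \<open>y' = \<i> \<kappa> w\<close>, \<open>w' = \<i> \<kappa> \<epsilon> y\<close> with control
  \<open>\<epsilon> \<in> [n\<^sub>1\<^sup>2, n\<^sub>2\<^sup>2]\<close> can be steered from the first line to the second in time \<open>c (s\<^sub>+ - s\<^sub>-)\<close>.
  The least modulus on a ray is thus a minimal time.  Four facts about this system give part (i).

  The set lies in the lower half-plane (\<open>resonant_wave_Im_neg\<close>): the flux \<open>Re (w cnj y)\<close> has
  derivative \<open>- Im k (|w|\<^sup>2 + \<epsilon> |y|\<^sup>2)\<close>, it is at most 0 at the left end because \<open>\<eta>\<^sub>- \<le> 0\<close> or
  \<open>\<eta>\<^sub>- = \<infinity>\<close>, and it is positive at the right end because \<open>\<eta>\<^sub>+ > 0\<close>.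

  The set is closed under multiplication by \<open>c \<ge> 1\<close> (\<open>resonant_wave_enlarge\<close>): since
  \<open>\<eta>\<^sub>+ \<in> [n\<^sub>1, n\<^sub>2]\<close>, the control \<open>\<epsilon> = \<eta>\<^sub>+\<^sup>2\<close> is admissible and keeps the state on the target line, so
  one may arrive early and wait there.

  Every ray of the open lower half-plane other than the imaginary one is hit
  (\<open>resonant_wave_exists\<close>): under a constant control \<open>n\<^sup>2\<close> the combinations \<open>w + n y\<close> and
  \<open>w - n y\<close> evolve by reciprocal exponentials.  If \<open>Re \<kappa> \<noteq> 0\<close>, a real ratio \<open>w / y\<close> becomes
  real again after each half turn, and the quantity \<open>(w - n y) / (w + n y)\<close> is then multiplied by
  a negative factor of modulus less than 1 that does not depend on \<open>n\<close>.  So the ratio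
  tends to \<open>n\<close> alternately from both sides, unless it starts at \<open>-n\<close>, and the intermediate value theorem in \<open>n\<close> produces
  the ratio \<open>\<eta>\<^sub>+\<close> exactly (\<open>ratio_attained\<close>).

  The infimum defining \<open>\<rho>\<^sub>m\<^sub>i\<^sub>n\<close> is attained, because the set is topologically closed and stays away
  from 0 (\<open>resonant_wave_limit\<close>, \<open>not_resonant_wave_0\<close>).  Here the coefficient is eliminated:
  \<open>w' \<in> [n\<^sub>1\<^sup>2, n\<^sub>2\<^sup>2] \<i> k y\<close> is expressed by linear inequalities for the increments of \<open>w\<close>
  (\<open>slope_incl\<close>), which make sense without derivatives and survive uniform limits.  The theorem
  of Arzela and Ascoli supplies a limit; its component \<open>w\<close> is Lipschitz, hence differentiable almost
  everywhere, and convexity of the interval lets one read off an admissible coefficient from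
  \<open>w' / (\<i> k y)\<close> (\<open>wave_imp_solution\<close>).

  Part (ii) is a formal consequence: by (i) the set consists of the points \<open>c k\<close> with \<open>c \<ge> 1\<close> and
  \<open>k\<close> on the frontier of minimal modulus, so both sides of the formula are infima of the same set.
\<close>

section \<open>Lipschitz functions are differentiable almost everywhere\<close>

text \<open>By Vitali's theorem, almost all of \<open>E\<close> is covered by disjoint intervals, inside an open set
hardly larger than \<open>E\<close>, on which the slope of \<open>f\<close> is at most \<open>p\<close>. The remaining null set has a null
image because \<open>f\<close> is Lipschitz.\<close>

lemma measure_image_le_if_small_slopes:
  fixes f :: "real \<Rightarrow> real"
  assumes mono: "strict_mono f"
    and Lip: "\<And>x y. \<bar>f y - f x\<bar> \<le> B * \<bar>y - x\<bar>"
    and E: "E \<in> lmeasurable" and fE: "f ` E \<in> lmeasurable" and p: "0 \<le> p"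
    and small: "\<And>x d. x \<in> E \<Longrightarrow> 0 < d \<Longrightarrow>
        \<exists>u v. u < x \<and> x < v \<and> v - u < d \<and> f v - f u \<le> p * (v - u)"
  shows "measure lebesgue (f ` E) \<le> p * measure lebesgue E"
proof -
  have "measure lebesgue (f ` E) \<le> p * (measure lebesgue E + e)" if "0 < e" for e
  proof -
    obtain U where U: "open U" "E \<subseteq> U" "U - E \<in> lmeasurable"
        "emeasure lebesgue (U - E) < ennreal e"
      using sets_lebesgue_outer_open[OF fmeasurableD[OF E] \<open>0 < e\<close>] by metis
    have UE: "U = E \<union> (U - E)" using U by auto
    have Um: "U \<in> lmeasurable"
      using fmeasurable.Un[OF E U(3)] UE by simp
    have "measure lebesgue (U - E) \<le> e"
      using U(3,4) \<open>0 < e\<close> by (simp add: emeasure_eq_measure2 ennreal_less_iff)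
    moreover have "measure lebesgue U \<le> measure lebesgue E + measure lebesgue (U - E)"
      using measure_Un_le[of E lebesgue "U - E"] E U(3) UE by (metis fmeasurableD)
    ultimately have mU: "measure lebesgue U \<le> measure lebesgue E + e" by simp
    define K where "K = {(u, v). u < v \<and> {u<..<v} \<subseteq> U \<and> f v - f u \<le> p * (v - u)}"
    define c where "c = (\<lambda>(u::real, v). (u + v) / 2)"
    define r where "r = (\<lambda>(u::real, v). (v - u) / 2)"
    have ball: "ball (c i) (r i) = {fst i<..<snd i}" for i
      by (auto simp: c_def r_def ball_def dist_real_def abs_less_iff split: prod.splits; argo)
    have cover: "\<exists>i. i \<in> K \<and> x \<in> ball (c i) (r i) \<and> r i < d" if x: "x \<in> E" and d: "0 < d" for x d
    proof -
      obtain \<delta> where \<delta>: "0 < \<delta>" "ball x \<delta> \<subseteq> U"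
        using U x by (meson openE subsetD)
      obtain u v where uv: "u < x" "x < v" "v - u < min d \<delta>" "f v - f u \<le> p * (v - u)"
        using small[OF x, of "min d \<delta>"] d \<delta> by auto
      have "{u<..<v} \<subseteq> ball x \<delta>"
        using uv by (auto simp: dist_real_def abs_less_iff)
      then have "(u, v) \<in> K" using uv \<delta> by (auto simp: K_def)
      then show ?thesis
        using uv d by (intro exI[of _ "(u, v)"]) (auto simp: ball, auto simp: r_def)
    qed
    obtain C where C: "countable C" "C \<subseteq> K"
        "pairwise (\<lambda>i j. disjnt (ball (c i) (r i)) (ball (c j) (r j))) C"
        "negligible (E - (\<Union>i\<in>C. ball (c i) (r i)))"
      by (rule Vitali_covering_theorem_balls[of E K c r]) (use cover in \<open>auto\<close>)
    define W where "W = (\<Union>i\<in>C. {f (fst i)<..<f (snd i)})"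
    have fin: "measure lebesgue (\<Union>i\<in>I. {f (fst i)<..<f (snd i)}) \<le> p * measure lebesgue U"
      if I: "I \<subseteq> C" "finite I" for I
    proof -
      have lt: "fst i < snd i" "f (snd i) - f (fst i) \<le> p * (snd i - fst i)" "{fst i<..<snd i} \<subseteq> U"
        if "i \<in> I" for i
      proof -
        have "i \<in> K" using that I C(2) by auto
        then show "fst i < snd i" "f (snd i) - f (fst i) \<le> p * (snd i - fst i)" "{fst i<..<snd i} \<subseteq> U"
          by (simp_all add: K_def case_prod_unfold)
      qed
      have "measure lebesgue (\<Union>i\<in>I. {f (fst i)<..<f (snd i)})
          \<le> (\<Sum>i\<in>I. measure lebesgue {f (fst i)<..<f (snd i)})"
        by (rule measure_UNION_le) (use I in auto)
      also have "\<dots> = (\<Sum>i\<in>I. f (snd i) - f (fst i))"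
        using lt(1) strict_mono_less[OF mono] by (intro sum.cong) (auto simp: less_imp_le)
      also have "\<dots> \<le> (\<Sum>i\<in>I. p * (snd i - fst i))"
        by (rule sum_mono) (use lt in auto)
      also have "\<dots> = p * (\<Sum>i\<in>I. measure lebesgue {fst i<..<snd i})"
        unfolding sum_distrib_left using lt(1) by (intro sum.cong) (auto simp: less_imp_le)
      also have "(\<Sum>i\<in>I. measure lebesgue {fst i<..<snd i}) = measure lebesgue (\<Union>i\<in>I. {fst i<..<snd i})"
      proof (rule measure_negligible_finite_Union_image[symmetric])
        show "pairwise (\<lambda>x y. negligible ({fst x<..<snd x} \<inter> {fst y<..<snd y})) I"
          using pairwise_subset[OF C(3) I(1)]
          unfolding ball pairwise_def disjnt_def by auto
      qed (use I in auto)
      also have "\<dots> \<le> measure lebesgue U"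
        by (rule measure_mono_fmeasurable[OF _ _ Um]) (use lt(3) I in \<open>blast, auto\<close>)
      finally show ?thesis using p by (simp add: mult_left_mono)
    qed
    have W: "W \<in> lmeasurable" "measure lebesgue W \<le> p * measure lebesgue U"
      unfolding W_def
      by (rule fmeasurable_UN_bound measure_UN_bound, use C fin in auto)+
    let ?N = "E - (\<Union>i\<in>C. ball (c i) (r i))"
    have N: "negligible (f ` ?N)"
      by (rule negligible_locally_Lipschitz_image[OF _ C(4)]) (use Lip in \<open>auto intro!: exI[of _ UNIV] exI[of _ B]\<close>)
    have "f ` E \<subseteq> W \<union> f ` ?N"
    proof
      fix z assume "z \<in> f ` E"
      then obtain x where x: "x \<in> E" "z = f x" by auto
      show "z \<in> W \<union> f ` ?N"
      proof (cases "x \<in> ?N")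
        case False
        then obtain i where i: "i \<in> C" "x \<in> {fst i<..<snd i}"
          using x by (auto simp: ball)
        then have "f x \<in> {f (fst i)<..<f (snd i)}"
          using strict_mono_less[OF mono] by auto
        then show ?thesis using x i by (auto simp: W_def)
      qed (use x in auto)
    qed
    then have "measure lebesgue (f ` E) \<le> measure lebesgue (W \<union> f ` ?N)"
      by (rule measure_mono_fmeasurable)
        (use fE W N in \<open>auto intro: fmeasurable.Un negligible_imp_measurable\<close>)
    also have "\<dots> = measure lebesgue W"
      using W N by (intro measure_Un_null_set) (auto simp: negligible_iff_null_sets)
    also have "\<dots> \<le> p * measure lebesgue U" by (rule W)
    also have "\<dots> \<le> p * (measure lebesgue E + e)"
      using mU p by (rule mult_left_mono)
    finally show ?thesis .
  qed
  then have "measure lebesgue (f ` E) \<le> p * measure lebesgue E + e" if "0 < e" for e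
  proof -
    have "measure lebesgue (f ` E) \<le> p * (measure lebesgue E + e / (p + 1))"
      using that p by (intro \<open>\<And>e. 0 < e \<Longrightarrow> measure lebesgue (f ` E) \<le> p * (measure lebesgue E + e)\<close>) auto
    also have "\<dots> = p * measure lebesgue E + e * (p / (p + 1))"
      by (simp add: algebra_simps)
    also have "e * (p / (p + 1)) \<le> e * 1"
      using that p by (intro mult_left_mono) auto
    finally show ?thesis by simp
  qed
  then show ?thesis by (rule field_le_epsilon)
qed

text \<open>The slopes are taken over intervals that contain the point in their interior, not over intervals
with the point as an endpoint: this makes both sets open, so that the exceptional set below is
a Borel set for trivial reasons.\<close>

definition straddle_below :: "(real \<Rightarrow> real) \<Rightarrow> real \<Rightarrow> real \<Rightarrow> real set" where
  "straddle_below f p d = {x. \<exists>u v. u < x \<and> x < v \<and> v - u < d \<and> f v - f u < p * (v - u)}"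

definition straddle_above :: "(real \<Rightarrow> real) \<Rightarrow> real \<Rightarrow> real \<Rightarrow> real set" where
  "straddle_above f q d = {x. \<exists>u v. u < x \<and> x < v \<and> v - u < d \<and> f v - f u > q * (v - u)}"

lemma open_straddle: "open (straddle_below f p d)" "open (straddle_above f q d)"
proof -
  have "straddle_below f p d = (\<Union>(u, v) \<in> {(u, v). v - u < d \<and> f v - f u < p * (v - u)}. {u<..<v})"
    by (fastforce simp: straddle_below_def)
  then show "open (straddle_below f p d)"
    by (simp only:) (auto intro!: open_UN)
  have "straddle_above f q d = (\<Union>(u, v) \<in> {(u, v). v - u < d \<and> f v - f u > q * (v - u)}. {u<..<v})"
    by (fastforce simp: straddle_above_def)
  then show "open (straddle_above f q d)"
    by (simp only:) (auto intro!: open_UN)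
qed

definition oscillating_slopes :: "(real \<Rightarrow> real) \<Rightarrow> real \<Rightarrow> real \<Rightarrow> real set" where
  "oscillating_slopes f p q = (\<Inter>d\<in>{0<..}. straddle_below f p d \<inter> straddle_above f q d)"

text \<open>Let \<open>E\<close> be a bounded piece of this set. The small slopes give \<open>|f(E)| \<le> p |E|\<close>. The large slopes are
small slopes of the inverse function, so \<open>|E| \<le> |f(E)| / q\<close>. As \<open>p < q\<close>, the measure \<open>|E|\<close> is 0.
The lower bound on the slopes of \<open>f\<close> is what makes the inverse Lipschitz.\<close>

lemma negligible_oscillating_slopes:
  fixes f :: "real \<Rightarrow> real"
  assumes slopes: "\<And>x y. x \<le> y \<Longrightarrow> m * (y - x) \<le> f y - f x \<and> f y - f x \<le> B * (y - x)"
    and m: "0 < m" and pq: "p < q"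
  shows "negligible (oscillating_slopes f p q)"
proof -
  have mono: "strict_mono f"
  proof (rule strict_monoI)
    fix x y :: real assume "x < y"
    then have "0 < m * (y - x)" using m by simp
    then show "f x < f y" using slopes[of x y] \<open>x < y\<close> by simp
  qed
  have Lip: "\<bar>f y - f x\<bar> \<le> B * \<bar>y - x\<bar>" for x y
    using slopes[of x y] slopes[of y x] strict_mono_less_eq[OF mono, of x y]
      strict_mono_less_eq[OF mono, of y x] by (cases "x \<le> y") auto
  have Bm: "m \<le> B" using slopes[of 0 1] by simp
  have cont: "continuous_on UNIV f"
    by (rule lipschitz_on_continuous_on[of B])
      (use Lip m Bm in \<open>auto intro!: lipschitz_onI simp: dist_real_def abs_minus_commute\<close>)
  have surj: "\<exists>x. f x = y" for y
  proof -
    define R where "R = \<bar>y - f 0\<bar> / m"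
    have R: "0 \<le> R" "m * R = \<bar>y - f 0\<bar>" using m by (auto simp: R_def)
    have "f (-R) \<le> y" "y \<le> f R"
      using slopes[of "-R" 0] slopes[of 0 R] R by auto
    then show ?thesis
      using IVT'[of f "-R" y R] R continuous_on_subset[OF cont] by auto
  qed
  define g where "g = inv f"
  have gf: "g (f x) = x" for x
    unfolding g_def using strict_mono_on_imp_inj_on[OF mono] by simp
  have fg: "f (g y) = y" for y
    unfolding g_def using surj by (metis f_inv_into_f rangeI)
  have gmono: "strict_mono g"
    by (rule strict_monoI) (metis fg mono strict_mono_less)
  have gLip: "\<bar>g y - g x\<bar> \<le> (1 / m) * \<bar>y - x\<bar>" for x y
  proof -
    have "m * \<bar>g y - g x\<bar> \<le> \<bar>f (g y) - f (g x)\<bar>"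
      using slopes[of "g x" "g y"] slopes[of "g y" "g x"] by (cases "g x \<le> g y") auto
    then show ?thesis using m by (simp add: fg field_simps)
  qed
  define E where "E = oscillating_slopes f p q"
  \<comment> \<open>Countably many scales suffice, so the exceptional set is a Borel set.\<close>
  define T where "T n = straddle_below f p (1 / Suc n) \<inter> straddle_above f q (1 / Suc n)" for n
  have T_E: "x \<in> E" if all: "\<And>n. x \<in> T n" for x
    unfolding E_def oscillating_slopes_def
  proof (rule INT_I)
    fix d :: real assume "d \<in> {0<..}"
    then have "0 < d" by simp
    then obtain n where n: "1 / real (Suc n) < d" by (rule nat_approx_posE)
    show "x \<in> straddle_below f p d \<inter> straddle_above f q d"
      using all[of n] n by (force simp: T_def straddle_below_def straddle_above_def)
  qed
  have E_T: "x \<in> T n" if "x \<in> E" for x n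
    using that unfolding E_def oscillating_slopes_def T_def by (rule INT_D) simp
  have "E = (\<Inter>n. T n)"
    by (rule set_eqI, rule iffI) (use T_E E_T in \<open>blast, blast\<close>)
  moreover have "T n \<in> sets borel" for n
    unfolding T_def by (rule borel_open, rule open_Int) (rule open_straddle)+
  ultimately have Eb: "E \<in> sets borel"
    by (simp only:) (rule sets.countable_INT'', simp_all)
  have "negligible (E \<inter> {-R<..<R})" for R
  proof -
    let ?E = "E \<inter> {-R<..<R}"
    have sE: "?E \<in> sets borel" using Eb by auto
    have "?E \<in> lmeasurable"
      by (rule bounded_set_imp_lmeasurable) (use sE in \<open>auto intro!: bounded_Int\<close>)
    have im: "f ` ?E = g -` ?E"
      by (auto simp: gf fg) (metis fg imageI Int_iff greaterThanLessThan_iff)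
    have gm: "g \<in> borel_measurable borel"
      by (intro borel_measurable_continuous_onI lipschitz_on_continuous_on[of "1/m"] lipschitz_onI)
        (use gLip m in \<open>auto simp: dist_real_def abs_minus_commute\<close>)
    have "f ` ?E \<in> sets borel"
      unfolding im using measurable_sets[OF gm sE] by simp
    moreover have "bounded (f ` ?E)"
    proof -
      have "f ` ?E \<subseteq> {f (-R)..f R}"
        using strict_mono_less_eq[OF mono] by auto
      then show ?thesis by (rule bounded_subset[OF bounded_closed_interval])
    qed
    ultimately have "f ` ?E \<in> lmeasurable"
      by (intro bounded_set_imp_lmeasurable) simp_all
    show ?thesis
    proof (cases "0 < p")
      case False
      have "E = {}"
      proof (rule equals0I)
        fix x assume "x \<in> E"
        then have "x \<in> straddle_below f p 1"
          unfolding E_def oscillating_slopes_def by simp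
        then obtain u v where "u < x" "x < v" and uv0: "f v - f u < p * (v - u)"
          unfolding straddle_below_def by blast
        then have uv: "u < v" "f v - f u < p * (v - u)" by simp_all
        moreover have "p * (v - u) \<le> 0" using False uv by (simp add: mult_nonpos_nonneg)
        moreover have "0 < m * (v - u)" using m uv by simp
        ultimately show False using slopes[of u v] by simp
      qed
      then show ?thesis by simp
    next
      case True
      then have q: "0 < q" using pq by simp
      have 1: "measure lebesgue (f ` ?E) \<le> p * measure lebesgue ?E"
      proof (rule measure_image_le_if_small_slopes[OF mono Lip])
        fix x d :: real assume "x \<in> ?E" "0 < d"
        then have "x \<in> straddle_below f p d"
          unfolding E_def oscillating_slopes_def by simp
        then show "\<exists>u v. u < x \<and> x < v \<and> v - u < d \<and> f v - f u \<le> p * (v - u)"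
          unfolding straddle_below_def by (auto intro: less_imp_le)
      qed (use True \<open>?E \<in> lmeasurable\<close> \<open>f ` ?E \<in> lmeasurable\<close> in auto)
      have gfE: "g ` f ` ?E = ?E" by (auto simp: gf image_image)
      have 2: "measure lebesgue (g ` f ` ?E) \<le> (1 / q) * measure lebesgue (f ` ?E)"
      proof (rule measure_image_le_if_small_slopes[OF gmono gLip])
        fix z d :: real assume "z \<in> f ` ?E" and d: "0 < d"
        then obtain x where x: "x \<in> ?E" "z = f x" by auto
        have "x \<in> straddle_above f q (d / B)"
          using x d m Bm unfolding E_def oscillating_slopes_def by simp
        then obtain u v where uv: "u < x" "x < v" "v - u < d / B" "f v - f u > q * (v - u)"
          unfolding straddle_above_def by blast
        have "f v - f u < d"
        proof -
          have "f v - f u \<le> B * (v - u)" using slopes[of u v] uv by simp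
          also have "\<dots> < d" using uv m Bm by (simp add: field_simps)
          finally show ?thesis .
        qed
        moreover have "v - u \<le> (1 / q) * (f v - f u)"
          using uv q by (simp add: field_simps)
        ultimately show "\<exists>u v. u < z \<and> z < v \<and> v - u < d \<and> g v - g u \<le> 1 / q * (v - u)"
          using uv x strict_mono_less[OF mono] by (intro exI[of _ "f u"] exI[of _ "f v"]) (auto simp: gf)
      qed (use q \<open>?E \<in> lmeasurable\<close> \<open>f ` ?E \<in> lmeasurable\<close> gfE in auto)
      have "q * measure lebesgue ?E \<le> p * measure lebesgue ?E"
        using 1 2 q unfolding gfE by (simp add: field_simps)
      then have "measure lebesgue ?E \<le> 0"
        using pq by (metis mult_le_cancel_right not_le)
      then have "measure lebesgue ?E = 0"
        by (simp add: measure_le_0_iff)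
      then show ?thesis
        using \<open>?E \<in> lmeasurable\<close> negligible_iff_measure by blast
    qed
  qed
  then have "negligible (\<Union>n::nat. E \<inter> {- real n<..<real n})"
    by (intro negligible_countable_Union) auto
  moreover have "E \<subseteq> (\<Union>n::nat. E \<inter> {- real n<..<real n})"
  proof
    fix x assume "x \<in> E"
    moreover obtain n where "\<bar>x\<bar> < real n" using reals_Archimedean2 by blast
    ultimately show "x \<in> (\<Union>n::nat. E \<inter> {- real n<..<real n})"
      by (auto simp: abs_less_iff intro!: exI[of _ n])
  qed
  ultimately show ?thesis unfolding E_def by (rule negligible_subset)
qed

text \<open>The derivative is the supremum of the numbers that eventually bound the straddling slopes from
below. No rational gap separates it from the eventual upper bounds, so the straddling slopes
converge to it, and letting one endpoint tend to \<open>x\<close> gives the one-sided difference quotients.\<close>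

lemma differentiable_if_no_oscillating_slopes:
  fixes f :: "real \<Rightarrow> real"
  assumes slopes: "\<And>x y. x \<le> y \<Longrightarrow> m * (y - x) \<le> f y - f x \<and> f y - f x \<le> B * (y - x)"
    and x: "\<And>p q. p \<in> \<rat> \<Longrightarrow> q \<in> \<rat> \<Longrightarrow> p < q \<Longrightarrow> x \<notin> oscillating_slopes f p q"
  shows "\<exists>D. (f has_vector_derivative D) (at x)"
proof -
  define low where "low p \<longleftrightarrow> (\<exists>d>0. x \<notin> straddle_below f p d)" for p
  define upp where "upp q \<longleftrightarrow> (\<exists>d>0. x \<notin> straddle_above f q d)" for q
  have straddle_mono: "straddle_below f p d \<subseteq> straddle_below f p d'"
      "straddle_above f p d \<subseteq> straddle_above f p d'" if "d \<le> d'" for p d d'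
    using that by (force simp: straddle_below_def straddle_above_def)+
  have low_mono: "low p" if "low p'" "p \<le> p'" for p p'
  proof -
    have "straddle_below f p d \<subseteq> straddle_below f p' d" for d
      using that(2) by (auto simp: straddle_below_def)
        (smt (verit) mult_right_mono)
    then show ?thesis using that(1) by (auto simp: low_def)
  qed
  have dich: "low p \<or> upp q" if "p \<in> \<rat>" "q \<in> \<rat>" "p < q" for p q
    using x[OF that] by (auto simp: oscillating_slopes_def low_def upp_def)
  have "low m"
  proof -
    have "x \<notin> straddle_below f m 1"
    proof
      assume "x \<in> straddle_below f m 1"
      then obtain u v where "u < x" "x < v" "f v - f u < m * (v - u)"
        by (auto simp: straddle_below_def)
      then show False using slopes[of u v] by simp
    qed
    then show ?thesis unfolding low_def by (intro exI[of _ 1]) simp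
  qed
  have bd: "p \<le> B" if lowp: "low p" for p
  proof -
    obtain d where d: "0 < d" "x \<notin> straddle_below f p d" using lowp by (auto simp: low_def)
    define u v where "u = x - d / 4" and "v = x + d / 4"
    have "u < x" "x < v" "v - u < d" using d by (auto simp: u_def v_def)
    then have "\<not> f v - f u < p * (v - u)"
      using d unfolding straddle_below_def by blast
    moreover have "f v - f u \<le> B * (v - u)" using slopes[of u v] d by (auto simp: u_def v_def)
    ultimately have "p * (v - u) \<le> B * (v - u)" by simp
    moreover have "0 < v - u" using d by (simp add: u_def v_def)
    ultimately show ?thesis by simp
  qed
  define D where "D = Sup (Collect low)"
  have bdd: "bdd_above (Collect low)" using bd by (auto intro!: bdd_aboveI)
  have lowD: "low p" if "p < D" for p
    using less_cSupD[of "Collect low" p] \<open>low m\<close> that low_mono unfolding D_def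
    by (metis empty_iff less_imp_le mem_Collect_eq)
  have uppD: "upp q" if q: "D < q" for q
  proof -
    obtain p' where p': "D < p'" "p' < q" "p' \<in> \<rat>"
      using Rats_dense_in_real[OF q] by blast
    obtain q' where q': "p' < q'" "q' < q" "q' \<in> \<rat>"
      using Rats_dense_in_real[OF p'(2)] by blast
    have "\<not> low p'"
      using p' cSup_upper[OF _ bdd, of p'] by (auto simp: D_def)
    then have "upp q'" using dich p' q' by blast
    moreover have "straddle_above f q d \<subseteq> straddle_above f q' d" for d
      using q' by (auto simp: straddle_above_def) (smt (verit) mult_right_mono)
    ultimately show ?thesis by (auto simp: upp_def)
  qed
  have cont: "isCont f x"
  proof -
    have "continuous_on UNIV f"
    proof (rule lipschitz_on_continuous_on[of "\<bar>m\<bar> + \<bar>B\<bar>"], rule lipschitz_onI)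
      have *: "\<bar>f b - f a\<bar> \<le> (\<bar>m\<bar> + \<bar>B\<bar>) * (b - a)" if "a \<le> b" for a b
        using slopes[OF that] that mult_right_mono[of "-\<bar>m\<bar>" m "b - a"] mult_right_mono[of B "\<bar>B\<bar>" "b - a"]
        unfolding distrib_right abs_le_iff 
        by (smt (verit) mult_minus_left mult_nonneg_nonneg)
      show "dist (f a) (f b) \<le> (\<bar>m\<bar> + \<bar>B\<bar>) * dist a b" for a b
        using *[of a b] *[of b a] by (cases "a \<le> b") (auto simp: dist_real_def)
    qed auto
    then show ?thesis by (simp add: continuous_on_eq_continuous_at)
  qed
  have "(f has_vector_derivative D) (at x)"
    unfolding has_vector_derivative_def has_derivative_at_alt
  proof (intro conjI allI impI)
    fix e :: real assume e: "0 < e"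
    obtain d1 where d1: "0 < d1" "x \<notin> straddle_below f (D - e) d1"
      using lowD[of "D - e"] e by (auto simp: low_def)
    obtain d2 where d2: "0 < d2" "x \<notin> straddle_above f (D + e) d2"
      using uppD[of "D + e"] e by (auto simp: upp_def)
    define d where "d = min d1 d2"
    have d: "0 < d" using d1 d2 by (simp add: d_def)
    have st: "\<bar>f v - f u - (v - u) * D\<bar> \<le> e * (v - u)" if "u < x" "x < v" "v - u < d" for u v
    proof -
      have "\<not> f v - f u < (D - e) * (v - u)" "\<not> f v - f u > (D + e) * (v - u)"
        using d1(2) d2(2) that unfolding straddle_below_def straddle_above_def d_def by auto
      then show ?thesis by (simp add: abs_le_iff algebra_simps)
    qed
    have right: "\<bar>f v - f x - (v - x) * D\<bar> \<le> e * (v - x)" if "x < v" "v - x < d" for v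
    proof (rule tendsto_le)
      show "((\<lambda>u. e * (v - u)) \<longlongrightarrow> e * (v - x)) (at_left x)" by (intro tendsto_intros)
      show "((\<lambda>u. \<bar>f v - f u - (v - u) * D\<bar>) \<longlongrightarrow> \<bar>f v - f x - (v - x) * D\<bar>) (at_left x)"
        using cont by (intro tendsto_intros) (auto simp: isCont_def filterlim_at_split)
      show "\<forall>\<^sub>F u in at_left x. \<bar>f v - f u - (v - u) * D\<bar> \<le> e * (v - u)"
        unfolding eventually_at_left_field using that st
        by (intro exI[of _ "v - d"]) auto
    qed auto
    have left: "\<bar>f x - f u - (x - u) * D\<bar> \<le> e * (x - u)" if "u < x" "x - u < d" for u
    proof (rule tendsto_le)
      show "((\<lambda>v. e * (v - u)) \<longlongrightarrow> e * (x - u)) (at_right x)" by (intro tendsto_intros)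
      show "((\<lambda>v. \<bar>f v - f u - (v - u) * D\<bar>) \<longlongrightarrow> \<bar>f x - f u - (x - u) * D\<bar>) (at_right x)"
        using cont by (intro tendsto_intros) (auto simp: isCont_def filterlim_at_split)
      show "\<forall>\<^sub>F v in at_right x. \<bar>f v - f u - (v - u) * D\<bar> \<le> e * (v - u)"
        unfolding eventually_at_right_field using that st
        by (intro exI[of _ "u + d"]) auto
    qed auto
    show "\<exists>d>0. \<forall>y. norm (y - x) < d \<longrightarrow> norm (f y - f x - (y - x) *\<^sub>R D) \<le> e * norm (y - x)"
    proof (intro exI[of _ d] conjI allI impI d)
      fix y assume y: "norm (y - x) < d"
      show "norm (f y - f x - (y - x) *\<^sub>R D) \<le> e * norm (y - x)"
        using left[of y] right[of y] y 
        by (cases y x rule: linorder_cases) (auto simp: algebra_simps)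
    qed
  qed (rule bounded_linear_scaleR_left)
  then show ?thesis by blast
qed

text \<open>Adding a linear function turns a Lipschitz function into one whose slopes lie between two
positive constants.\<close>

theorem Lipschitz_imp_AE_differentiable_real:
  fixes h :: "real \<Rightarrow> real"
  assumes Lip: "\<And>x y. \<bar>h y - h x\<bar> \<le> L * \<bar>y - x\<bar>"
  shows "negligible {x. \<nexists>D. (h has_vector_derivative D) (at x)}"
proof -
  define f where "f x = h x + (L + 1) * x" for x
  have slopes: "1 * (y - x) \<le> f y - f x \<and> f y - f x \<le> (2 * L + 1) * (y - x)" if "x \<le> y" for x y
    using Lip[of y x] that by (auto simp: f_def algebra_simps abs_le_iff)
  let ?N = "\<Union>p\<in>\<rat>. \<Union>q\<in>\<rat> \<inter> {p<..}. oscillating_slopes f p q"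
  have "negligible ?N"
    using negligible_oscillating_slopes[OF slopes]
    by (intro negligible_countable_Union countable_image) (auto simp: countable_rat intro!: countable_Int1)
  moreover have "{x. \<nexists>D. (h has_vector_derivative D) (at x)} \<subseteq> ?N"
  proof (rule ccontr)
    assume "\<not> ?thesis"
    then obtain x where x: "x \<notin> ?N" and nd: "\<nexists>D. (h has_vector_derivative D) (at x)" by blast
    obtain D where "(f has_vector_derivative D) (at x)"
      using differentiable_if_no_oscillating_slopes[OF slopes, of x] x by auto
    then have "((\<lambda>x. f x - (L + 1) * x) has_vector_derivative D - (L + 1) * 1) (at x)"
      by (intro derivative_intros)
    then show False using nd by (auto simp: f_def)
  qed
  ultimately show ?thesis by (rule negligible_subset)
qed

theorem Lipschitz_imp_AE_differentiable_complex:
  fixes h :: "real \<Rightarrow> complex"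
  assumes Lip: "\<And>x y. norm (h y - h x) \<le> L * \<bar>y - x\<bar>"
  shows "negligible {x. \<nexists>D. (h has_vector_derivative D) (at x)}"
proof -
  let ?N1 = "{x. \<nexists>D. ((\<lambda>t. Re (h t)) has_vector_derivative D) (at x)}"
  let ?N2 = "{x. \<nexists>D. ((\<lambda>t. Im (h t)) has_vector_derivative D) (at x)}"
  have "negligible ?N1"
    by (rule Lipschitz_imp_AE_differentiable_real[of _ L])
      (metis Lip abs_Re_le_cmod minus_complex.simps(1) order_trans)
  moreover have "negligible ?N2"
    by (rule Lipschitz_imp_AE_differentiable_real[of _ L])
      (metis Lip abs_Im_le_cmod minus_complex.simps(2) order_trans)
  ultimately have "negligible (?N1 \<union> ?N2)" by (rule negligible_Un)
  moreover have "{x. \<nexists>D. (h has_vector_derivative D) (at x)} \<subseteq> ?N1 \<union> ?N2"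
  proof (rule ccontr)
    assume "\<not> ?thesis"
    then obtain x D1 D2 where D: "((\<lambda>t. Re (h t)) has_vector_derivative D1) (at x)"
        "((\<lambda>t. Im (h t)) has_vector_derivative D2) (at x)"
      and nd: "\<nexists>D. (h has_vector_derivative D) (at x)" by blast
    have "((\<lambda>t. of_real (Re (h t)) + \<i> * of_real (Im (h t))) has_vector_derivative
        of_real D1 + \<i> * of_real D2) (at x)"
      by (intro derivative_intros bounded_linear.has_vector_derivative[OF bounded_linear_of_real] D
          has_vector_derivative_mult_right)
    then have "(h has_vector_derivative of_real D1 + \<i> * of_real D2) (at x)"
      by (simp add: complex_eq[symmetric])
    then show False using nd by blast
  qed
  ultimately show ?thesis by (rule negligible_subset)
qed

section \<open>Absolutely continuous functions\<close>

text \<open>A mean value inequality in which the derivative is controlled only almost everywhere.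
Take a tagged division so fine that intervals tagged outside the exceptional set obey the
bound up to an error proportional to their length, while those tagged in the exceptional set lie in
an open set of small measure; absolute continuity makes the contribution of the latter small.\<close>

lemma abs_cont_on_increment_le:
  fixes z :: "real \<Rightarrow> complex"
  assumes ac: "abs_cont_on {a..b} z" and N: "negligible N"
    and der: "\<And>x. x \<in> {a<..<b} - N \<Longrightarrow> \<exists>D. (z has_vector_derivative D) (at x) \<and> Re (c * D) \<le> M"
    and st: "a \<le> s" "s \<le> t" "t \<le> b"
  shows "Re (c * (z t - z s)) \<le> M * (t - s)"
proof -
  define h where "h x = Re (c * z x) - M * x" for x
  have main: "h t - h s \<le> (t - s + norm c + \<bar>M\<bar>) * e" if e: "0 < e" for e
  proof -
    obtain \<delta> where \<delta>: "0 < \<delta>" "\<And>d T. d division_of T \<Longrightarrow> T \<subseteq> {a..b} \<Longrightarrow>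
        (\<Sum>K\<in>d. Sup K - Inf K) < \<delta> \<Longrightarrow> (\<Sum>K\<in>d. norm (z (Sup K) - z (Inf K))) < e"
      using ac e unfolding abs_cont_on_def by metis
    \<comment> \<open>The endpoints are treated as exceptional points, as no two-sided derivative is given
        there.\<close>
    define N' where "N' = N \<union> {a, b}"
    have N': "negligible N'" using N by (simp add: N'_def)
    have "0 < min \<delta> e" using \<delta> e by simp
    then obtain U where U: "open U" "N' \<subseteq> U" "U - N' \<in> lmeasurable"
        "emeasure lebesgue (U - N') < ennreal (min \<delta> e)"
      using sets_lebesgue_outer_open[OF negligible_imp_sets[OF N']] by metis
    have UN: "U = (U - N') \<union> N'" using U by auto
    have Um: "U \<in> lmeasurable"
      using fmeasurable.Un[OF U(3) negligible_imp_measurable[OF N']] UN by simp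
    have "measure lebesgue U = measure lebesgue (U - N')"
      using measure_Un_null_set[of "U - N'" lebesgue N'] U(3) N' UN
      by (simp add: negligible_iff_null_sets fmeasurableD)
    then have mU: "measure lebesgue U < \<delta>" "measure lebesgue U < e"
      using U(3,4) \<open>0 < min \<delta> e\<close> by (simp_all add: emeasure_eq_measure2 ennreal_less_iff)
    define e' where "e' = e / (norm c + 1)"
    have e': "0 < e'" "norm c * e' \<le> e"
    proof -
      have 1: "0 < norm c + 1" by (simp add: add_nonneg_pos)
      show "0 < e'" using e 1 by (simp add: e'_def)
      have "norm c * e \<le> e * (norm c + 1)" using e by (simp add: algebra_simps)
      then show "norm c * e' \<le> e" using 1 by (simp add: e'_def divide_le_eq)
    qed
    have "\<exists>r D. 0 < r \<and> (x \<in> {a<..<b} - N \<longrightarrow> Re (c * D) \<le> M \<and>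
        (\<forall>y. norm (y - x) < r \<longrightarrow> norm (z y - z x - (y - x) *\<^sub>R D) \<le> e' * norm (y - x)))" for x
    proof (cases "x \<in> {a<..<b} - N")
      case True
      then obtain D where "(z has_vector_derivative D) (at x)" "Re (c * D) \<le> M" using der by blast
      then show ?thesis
        using e'(1) unfolding has_vector_derivative_def has_derivative_at_alt by blast
    qed (auto intro: exI[of _ 1])
    then obtain r D where r: "\<And>x. 0 < r x"
      and D: "\<And>x. x \<in> {a<..<b} - N \<Longrightarrow> Re (c * D x) \<le> M"
      and zD: "\<And>x y. x \<in> {a<..<b} - N \<Longrightarrow> norm (y - x) < r x \<Longrightarrow>
        norm (z y - z x - (y - x) *\<^sub>R D x) \<le> e' * norm (y - x)"
      by metis
    define g where "g x = (if x \<in> N' then U else ball x (r x))" for x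
    have "gauge g" unfolding gauge_def g_def using r U by auto
    then obtain p where p: "p tagged_division_of {s..t}" "g fine p"
      by (rule fine_division_exists_real)
    have finp: "finite p" using p by auto
    have elem: "\<exists>u v. K = {u..v} \<and> u \<le> x \<and> x \<le> v \<and> s \<le> u \<and> v \<le> t \<and> K \<subseteq> g x" if "(x, K) \<in> p" for x K
    proof -
      have "x \<in> K" "K \<subseteq> {s..t}" "\<exists>u v. K = cbox u v"
        using tagged_division_ofD(2-4)[OF p(1) that] by auto
      then show ?thesis using fineD[OF p(2) that] by auto
    qed
    define bad where "bad = {(x, K) \<in> p. x \<in> N'}"
    have "bad \<subseteq> p" by (auto simp: bad_def)
    define F where "F = (\<lambda>(x::real, K). h (Sup K) - h (Inf K))"
    have len: "(\<Sum>(x, K)\<in>p. Sup K - Inf K) = t - s"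
      using additive_tagged_division_1[OF st(2) p(1), of "\<lambda>x. x"] by simp
    have good: "sum F (p - bad) \<le> e * (t - s)"
    proof -
      have "sum F (p - bad) \<le> (\<Sum>(x, K)\<in>p - bad. e * (Sup K - Inf K))"
      proof (rule sum_mono, clarify)
        fix x K assume xK: "(x, K) \<in> p" "(x, K) \<notin> bad"
        obtain u v where K: "K = {u..v}" "u \<le> x" "x \<le> v" "s \<le> u" "v \<le> t" "K \<subseteq> g x"
          using elem[OF xK(1)] by blast
        have x: "x \<notin> N'" using xK by (auto simp: bad_def)
        then have xI: "x \<in> {a<..<b} - N" using K st by (auto simp: N'_def)
        have "u \<in> K" "v \<in> K" using K by auto
        then have "u \<in> ball x (r x)" "v \<in> ball x (r x)"
          using K(6) x by (auto simp only: g_def if_False)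
        then have "norm (z u - z x - (u - x) *\<^sub>R D x) \<le> e' * norm (u - x)"
            "norm (z v - z x - (v - x) *\<^sub>R D x) \<le> e' * norm (v - x)"
          using zD[OF xI] by (auto simp: dist_real_def abs_minus_commute)
        then have "norm ((z v - z x - (v - x) *\<^sub>R D x) - (z u - z x - (u - x) *\<^sub>R D x)) \<le> e' * (v - u)"
          using K by (intro order_trans[OF norm_triangle_ineq4]) (auto simp: algebra_simps)
        moreover have "(z v - z x - (v - x) *\<^sub>R D x) - (z u - z x - (u - x) *\<^sub>R D x)
            = z v - z u - (v - u) *\<^sub>R D x" by (simp add: algebra_simps)
        ultimately have "norm (c * (z v - z u - (v - u) *\<^sub>R D x)) \<le> norm c * (e' * (v - u))"
          by (simp add: norm_mult mult_left_mono)
        also have "\<dots> \<le> e * (v - u)"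
          using e'(2) K by (simp add: mult.assoc[symmetric] mult_right_mono)
        finally have "Re (c * (z v - z u - (v - u) *\<^sub>R D x)) \<le> e * (v - u)"
          using complex_Re_le_cmod order_trans by blast
        moreover have "Re (c * (z v - z u - (v - u) *\<^sub>R D x))
            = Re (c * z v) - Re (c * z u) - (v - u) * Re (c * D x)" by (simp add: algebra_simps)
        moreover have "(v - u) * Re (c * D x) \<le> (v - u) * M"
          using D[OF xI] K by (intro mult_left_mono) auto
        ultimately have "h v - h u \<le> e * (v - u)" by (simp add: h_def algebra_simps)
        then show "F (x, K) \<le> e * (Sup K - Inf K)" using K by (simp add: F_def)
      qed
      also have "\<dots> \<le> (\<Sum>(x, K)\<in>p. e * (Sup K - Inf K))"
      proof (rule sum_mono2[OF finp])
        fix i assume "i \<in> p - (p - bad)"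
        then obtain x K where i: "i = (x, K)" "(x, K) \<in> p" by (cases i) auto
        then show "0 \<le> (case i of (x, K) \<Rightarrow> e * (Sup K - Inf K))"
          using elem[OF i(2)] e by auto
      qed auto
      also have "\<dots> = e * (t - s)"
        unfolding len[symmetric] sum_distrib_left by (simp add: case_prod_unfold)
      finally show ?thesis .
    qed
    have badle: "sum F bad \<le> (norm c + \<bar>M\<bar>) * e"
    proof -
      have part: "bad tagged_partial_division_of {s..t}"
        using p(1) tagged_partial_division_subset[OF _ \<open>bad \<subseteq> p\<close>] by (auto simp: tagged_division_of_def)
      define d where "d = snd ` bad"
      have div: "d division_of \<Union>d" unfolding d_def by (rule partial_division_of_tagged_division[OF part])
      have sub: "\<Union>d \<subseteq> {s..t}" using elem \<open>bad \<subseteq> p\<close> by (fastforce simp: d_def)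
      have dU: "\<Union>d \<subseteq> U"
      proof
        fix w assume "w \<in> \<Union>d"
        then obtain x K where xK: "(x, K) \<in> bad" "w \<in> K" by (auto simp: d_def)
        then have "K \<subseteq> g x" "x \<in> N'" using elem[of x K] by (auto simp: bad_def)
        then show "w \<in> U" using xK by (auto simp: g_def)
      qed
      have dK: "\<exists>u v. K = {u..v} \<and> u \<le> v" if Kd: "K \<in> d" for K
      proof -
        obtain x where "(x, K) \<in> bad" using Kd by (auto simp: d_def)
        then have "(x, K) \<in> p" using \<open>bad \<subseteq> p\<close> by (rule subsetD[rotated])
        then show ?thesis using elem[of x K] by auto
      qed
      have "(\<Sum>K\<in>d. Sup K - Inf K) = (\<Sum>K\<in>d. measure lebesgue K)"
        using dK by (intro sum.cong) fastforce+
      also have "\<dots> = measure lebesgue (\<Union>d)"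
        using content_division[OF div] by simp
      also have "\<dots> \<le> measure lebesgue U"
        by (rule measure_mono_fmeasurable[OF dU _ Um])
          (use lmeasurable_division[OF div] in \<open>simp add: fmeasurableD\<close>)
      finally have short: "(\<Sum>K\<in>d. Sup K - Inf K) \<le> measure lebesgue U" .
      define G where "G K = (if K = {} then 0 else
        norm c * norm (z (Sup K) - z (Inf K)) + \<bar>M\<bar> * (Sup K - Inf K))" for K
      have "sum F bad \<le> (\<Sum>(x, K)\<in>bad. G K)"
      proof (rule sum_mono, clarify)
        fix x K assume "(x, K) \<in> bad"
        then obtain u v where K: "K = {u..v}" "u \<le> v" using dK[of K] by (force simp: d_def)
        have "Re (c * (z v - z u)) \<le> norm c * norm (z v - z u)"
          by (metis complex_Re_le_cmod norm_mult)
        moreover have "- (M * (v - u)) \<le> \<bar>M\<bar> * (v - u)"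
          using K by (metis abs_ge_minus_self diff_ge_0_iff_ge minus_mult_left mult_right_mono)
        ultimately have "h v - h u \<le> norm c * norm (z v - z u) + \<bar>M\<bar> * (v - u)"
          by (simp add: h_def algebra_simps)
        then show "F (x, K) \<le> G K" using K by (simp add: F_def G_def)
      qed
      also have "\<dots> = sum G d"
        unfolding d_def
      proof (rule sum.over_tagged_division_lemma[OF tagged_partial_division_of_Union_self[OF part]])
        show "G (cbox u v) = 0" if "box u v = {}" for u v :: real
          using that by (cases "u = v") (auto simp: G_def box_eq_empty)
      qed
      also have "\<dots> = norm c * (\<Sum>K\<in>d. norm (z (Sup K) - z (Inf K))) + \<bar>M\<bar> * (\<Sum>K\<in>d. Sup K - Inf K)"
        unfolding sum_distrib_left sum.distrib[symmetric] using dK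
        by (intro sum.cong) (fastforce simp: G_def)+
      also have "\<dots> \<le> norm c * e + \<bar>M\<bar> * e"
      proof (intro add_mono mult_left_mono)
        show "(\<Sum>K\<in>d. norm (z (Sup K) - z (Inf K))) \<le> e"
          using \<delta>(2)[OF div] sub st short mU by fastforce
      qed (use short mU in auto)
      finally show ?thesis by (simp add: algebra_simps)
    qed
    have "h t - h s = sum F p"
      using additive_tagged_division_1[OF st(2) p(1), of h] by (simp add: F_def case_prod_unfold)
    also have "\<dots> = sum F (p - bad) + sum F bad"
      using sum.subset_diff[OF \<open>bad \<subseteq> p\<close> finp] by simp
    finally show ?thesis using good badle by (simp add: algebra_simps)
  qed
  have "h t - h s \<le> 0 + e" if "0 < e" for e
  proof -
    define C where "C = t - s + norm c + \<bar>M\<bar> + 1"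
    have C: "0 < C" using st by (simp add: C_def add_nonneg_pos)
    have "h t - h s \<le> (C - 1) * (e / C)" using main[of "e / C"] that C by (simp add: C_def)
    also have "\<dots> \<le> C * (e / C)" using that C by (intro mult_right_mono) auto
    finally show ?thesis using C by simp
  qed
  then have "h t - h s \<le> 0" by (rule field_le_epsilon)
  then show ?thesis by (simp add: h_def algebra_simps)
qed

lemma Lipschitz_imp_abs_cont_on:
  assumes Lip: "\<And>x y. x \<in> {a..b} \<Longrightarrow> y \<in> {a..b} \<Longrightarrow> norm (f y - f x) \<le> L * \<bar>y - x\<bar>"
  shows "abs_cont_on {a..b} f"
  unfolding abs_cont_on_def
proof (intro allI impI)
  fix e :: real assume e: "0 < e"
  show "\<exists>\<delta>>0. \<forall>d T. d division_of T \<and> T \<subseteq> {a..b} \<and> (\<Sum>K\<in>d. Sup K - Inf K) < \<delta> \<longrightarrow>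
        (\<Sum>K\<in>d. norm (f (Sup K) - f (Inf K))) < e"
  proof (intro exI[of _ "e / (\<bar>L\<bar> + 1)"] conjI allI impI)
    show "0 < e / (\<bar>L\<bar> + 1)" using e by (simp add: add_nonneg_pos)
    fix d T assume d: "d division_of T \<and> T \<subseteq> {a..b} \<and> (\<Sum>K\<in>d. Sup K - Inf K) < e / (\<bar>L\<bar> + 1)"
    have dK: "\<exists>u v. K = {u..v} \<and> u \<le> v \<and> a \<le> u \<and> v \<le> b" if Kd: "K \<in> d" for K
    proof -
      obtain u v where K: "K = {u..v}" "K \<subseteq> T" "K \<noteq> {}"
        using division_ofD(2-4)[OF conjunct1[OF d] Kd] by auto
      then have "u \<in> K" "v \<in> K" by auto
      then have "u \<in> {a..b}" "v \<in> {a..b}" using K d by blast+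
      then show ?thesis using K by auto
    qed
    have "(\<Sum>K\<in>d. norm (f (Sup K) - f (Inf K))) \<le> (\<Sum>K\<in>d. (\<bar>L\<bar> + 1) * (Sup K - Inf K))"
    proof (rule sum_mono)
      fix K assume "K \<in> d"
      then obtain u v where K: "K = {u..v}" "u \<le> v" "a \<le> u" "v \<le> b" using dK by blast
      have "norm (f v - f u) \<le> L * (v - u)" using Lip[of u v] K by simp
      also have "\<dots> \<le> (\<bar>L\<bar> + 1) * (v - u)" using K by (intro mult_right_mono) auto
      finally show "norm (f (Sup K) - f (Inf K)) \<le> (\<bar>L\<bar> + 1) * (Sup K - Inf K)" using K by simp
    qed
    also have "\<dots> = (\<bar>L\<bar> + 1) * (\<Sum>K\<in>d. Sup K - Inf K)" by (simp add: sum_distrib_left)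
    also have "\<dots> < (\<bar>L\<bar> + 1) * (e / (\<bar>L\<bar> + 1))"
      using d by (intro mult_strict_left_mono) (auto simp: add_nonneg_pos)
    finally show "(\<Sum>K\<in>d. norm (f (Sup K) - f (Inf K))) < e" by (simp add: add_nonneg_pos)
  qed
qed

section \<open>Differential inclusions as inequalities for increments\<close>

text \<open>The integrated form of \<open>f' \<in> [p, q] g\<close>: a closed convex set is the intersection of the half-planes
containing it, so the inclusion amounts to a bound on \<open>Re (c f')\<close> for every complex \<open>c\<close>, and \<open>M\<close>
bounds the maximum of \<open>Re (c e g)\<close> over \<open>e \<in> [p, q]\<close>, which is attained at an endpoint. No
derivative of \<open>f\<close> occurs, which makes the notion stable under limits.\<close>

definition slope_incl ::
  "real \<Rightarrow> real \<Rightarrow> (real \<Rightarrow> complex) \<Rightarrow> (real \<Rightarrow> complex) \<Rightarrow> real \<Rightarrow> real \<Rightarrow> bool" where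
  "slope_incl p q g f a b \<longleftrightarrow>
     (\<forall>s t c M. a \<le> s \<and> s \<le> t \<and> t \<le> b \<and>
        (\<forall>\<tau>\<in>{s..t}. p * Re (c * g \<tau>) \<le> M \<and> q * Re (c * g \<tau>) \<le> M) \<longrightarrow>
        Re (c * (f t - f s)) \<le> M * (t - s))"

lemma slope_inclD:
  assumes "slope_incl p q g f a b" "a \<le> s" "s \<le> t" "t \<le> b"
    and "\<And>\<tau>. s \<le> \<tau> \<Longrightarrow> \<tau> \<le> t \<Longrightarrow> p * Re (c * g \<tau>) \<le> M \<and> q * Re (c * g \<tau>) \<le> M"
  shows "Re (c * (f t - f s)) \<le> M * (t - s)"
  using assms unfolding slope_incl_def by auto

lemma scaled_le_if_endpoints_le:
  fixes x :: real
  assumes "p * x \<le> M" "q * x \<le> M" "p \<le> e" "e \<le> q"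
  shows "e * x \<le> M"
proof (cases "0 \<le> x")
  case True
  then have "e * x \<le> q * x" using assms by (intro mult_right_mono)
  then show ?thesis using assms by simp
next
  case False
  then have "e * x \<le> p * x" using assms by (intro mult_right_mono_neg) auto
  then show ?thesis using assms by simp
qed

lemma slope_incl_norm_le:
  assumes incl: "slope_incl p q g f a b" and pq: "0 \<le> p" "p \<le> q"
    and st: "a \<le> s" "s \<le> t" "t \<le> b"
    and K: "\<And>\<tau>. s \<le> \<tau> \<Longrightarrow> \<tau> \<le> t \<Longrightarrow> norm (g \<tau>) \<le> K"
  shows "norm (f t - f s) \<le> q * K * (t - s)"
proof (cases "f t = f s")
  case True
  have "0 \<le> norm (g s)" by simp
  also have "\<dots> \<le> K" using K[of s] st by simp
  finally show ?thesis using True pq st by simp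
next
  case False
  define c where "c = cnj (f t - f s) / norm (f t - f s)"
  have c: "norm c = 1" using False by (simp add: c_def norm_divide del: complex_cnj_diff)
  have "c * (f t - f s) = ((f t - f s) * cnj (f t - f s)) / norm (f t - f s)"
    by (simp add: c_def mult.commute del: complex_cnj_diff)
  also have "\<dots> = norm (f t - f s)"
    unfolding complex_norm_square[symmetric] using False by (simp add: power2_eq_square)
  finally have "c * (f t - f s) = norm (f t - f s)" .
  then have "norm (f t - f s) = Re (c * (f t - f s))" by simp
  also have "\<dots> \<le> q * K * (t - s)"
  proof (rule slope_inclD[OF incl st])
    fix \<tau> assume "s \<le> \<tau>" "\<tau> \<le> t"
    then have "Re (c * g \<tau>) \<le> K" "0 \<le> K"
      using K[of \<tau>] c complex_Re_le_cmod[of "c * g \<tau>"] order_trans[OF norm_ge_zero K[of \<tau>]]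
      unfolding norm_mult by (auto simp del: times_complex.simps)
    then have "p * Re (c * g \<tau>) \<le> p * K" "q * Re (c * g \<tau>) \<le> q * K" "p * K \<le> q * K"
      using pq by (auto intro: mult_left_mono mult_right_mono)
    then show "p * Re (c * g \<tau>) \<le> q * K \<and> q * Re (c * g \<tau>) \<le> q * K" by simp
  qed
  finally show ?thesis .
qed

lemma slope_incl_norm_le_abs:
  assumes incl: "slope_incl p q g f a b" and pq: "0 \<le> p" "p \<le> q"
    and st: "s \<in> {a..b}" "t \<in> {a..b}"
    and K: "\<And>\<tau>. \<tau> \<in> {a..b} \<Longrightarrow> norm (g \<tau>) \<le> K"
  shows "norm (f t - f s) \<le> q * K * \<bar>t - s\<bar>"
  using slope_incl_norm_le[OF incl pq, of s t K] slope_incl_norm_le[OF incl pq, of t s K] st K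
  by (cases "s \<le> t") (auto simp: norm_minus_commute)

lemma slope_incl_if_abs_cont:
  assumes ac: "abs_cont_on {a..b} f" and N: "negligible N" and "p \<le> q"
    and der: "\<And>x. x \<in> {a<..<b} - N \<Longrightarrow>
      \<exists>e. p \<le> e \<and> e \<le> q \<and> (f has_vector_derivative complex_of_real e * g x) (at x)"
  shows "slope_incl p q g f a b"
  unfolding slope_incl_def
proof (intro allI impI, elim conjE)
  fix s t c M
  assume st: "a \<le> s" "s \<le> t" "t \<le> b"
    and M: "\<forall>\<tau>\<in>{s..t}. p * Re (c * g \<tau>) \<le> M \<and> q * Re (c * g \<tau>) \<le> M"
  \<comment> \<open>The hypothesis on the derivative bounds \<open>M\<close> only on
      \<open>{s..t}\<close>, so the mean value inequality is applied there.\<close>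
  have "abs_cont_on {s..t} f"
    using ac st unfolding abs_cont_on_def by (meson atLeastatMost_subset_iff order_trans)
  then show "Re (c * (f t - f s)) \<le> M * (t - s)"
  proof (rule abs_cont_on_increment_le[OF _ N])
    fix x assume x: "x \<in> {s<..<t} - N"
    then obtain e where e: "p \<le> e" "e \<le> q" "(f has_vector_derivative complex_of_real e * g x) (at x)"
      using der[of x] st by auto
    have "Re (c * (complex_of_real e * g x)) = e * Re (c * g x)"
      by (simp add: algebra_simps)
    also have "\<dots> \<le> M"
      using scaled_le_if_endpoints_le[OF _ _ e(1,2)] M x by auto
    finally show "\<exists>D. (f has_vector_derivative D) (at x) \<and> Re (c * D) \<le> M"
      using e(3) by blast
  qed (use st in auto)
qed

lemma slope_incl_if_derivative:
  assumes der: "\<And>x. x \<in> {a..b} \<Longrightarrow> (f has_vector_derivative g x) (at x within {a..b})"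
  shows "slope_incl 1 1 g f a b"
  unfolding slope_incl_def
proof (intro allI impI, elim conjE)
  fix s t c M
  assume st: "a \<le> s" "s \<le> t" "t \<le> b"
    and M: "\<forall>\<tau>\<in>{s..t}. 1 * Re (c * g \<tau>) \<le> M \<and> 1 * Re (c * g \<tau>) \<le> M"
  have lin: "bounded_linear (\<lambda>w. Re (c * w))"
    using bounded_linear_compose[OF bounded_linear_Re bounded_linear_mult_right] by simp
  have "((\<lambda>x. Re (c * f x)) has_vector_derivative Re (c * g x)) (at x within {s..t})"
    if "x \<in> {s..t}" for x
    using bounded_linear.has_vector_derivative[OF lin der] that st
    by (auto intro: has_vector_derivative_within_subset[of _ _ _ "{a..b}"])
  then have "\<exists>x\<in>{s..t}. Re (c * f t) - Re (c * f s) = (t - s) * Re (c * g x)"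
    using mvt_very_simple[OF st(2), of "\<lambda>x. Re (c * f x)" "\<lambda>x h. h * Re (c * g x)"]
    by (simp add: has_vector_derivative_def)
  then obtain x where "x \<in> {s..t}" "Re (c * (f t - f s)) = (t - s) * Re (c * g x)"
    by (auto simp: algebra_simps)
  moreover have "(t - s) * Re (c * g x) \<le> (t - s) * M" if "x \<in> {s..t}"
    using M that st by (intro mult_left_mono) auto
  ultimately show "Re (c * (f t - f s)) \<le> M * (t - s)" by (simp add: mult.commute)
qed

text \<open>By continuity of \<open>g\<close>, a strict bound at \<open>x\<close> persists near \<open>x\<close>.\<close>

lemma slope_incl_difference_quotient_le:
  assumes incl: "slope_incl p q g f a b"
    and g: "continuous_on {a..b} g" and x: "x \<in> {a..b}"
    and M: "p * Re (c * g x) < M" "q * Re (c * g x) < M"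
  shows "\<exists>d>0. \<forall>s t. a \<le> s \<and> s \<le> t \<and> t \<le> b \<and> x - d < s \<and> t < x + d \<longrightarrow>
      Re (c * (f t - f s)) \<le> M * (t - s)"
proof -
  have "((\<lambda>t. p * Re (c * g t)) \<longlongrightarrow> p * Re (c * g x)) (at x within {a..b})"
    "((\<lambda>t. q * Re (c * g t)) \<longlongrightarrow> q * Re (c * g x)) (at x within {a..b})"
    using g x by (auto simp: continuous_on_def intro!: tendsto_intros)
  then have "\<forall>\<^sub>F t in at x within {a..b}. p * Re (c * g t) < M"
    "\<forall>\<^sub>F t in at x within {a..b}. q * Re (c * g t) < M"
    using M by (auto dest: order_tendstoD(2))
  then have "\<forall>\<^sub>F t in at x within {a..b}. p * Re (c * g t) < M \<and> q * Re (c * g t) < M"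
    by (rule eventually_conj)
  then obtain d where d: "d > 0"
    "\<And>t. t \<in> {a..b} \<Longrightarrow> t \<noteq> x \<Longrightarrow> dist t x < d \<Longrightarrow> p * Re (c * g t) < M \<and> q * Re (c * g t) < M"
    unfolding eventually_at by auto
  show ?thesis
  proof (intro exI[of _ d] conjI allI impI d(1), elim conjE)
    fix s t assume st: "a \<le> s" "s \<le> t" "t \<le> b" "x - d < s" "t < x + d"
    show "Re (c * (f t - f s)) \<le> M * (t - s)"
    proof (rule slope_inclD[OF incl st(1-3)])
      fix \<tau> assume "s \<le> \<tau>" "\<tau> \<le> t"
      then show "p * Re (c * g \<tau>) \<le> M \<and> q * Re (c * g \<tau>) \<le> M"
        using d(2)[of \<tau>] M st by (cases "\<tau> = x") (auto simp: dist_real_def less_imp_le)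
    qed
  qed
qed

lemma slope_incl_derivative_le:
  assumes incl: "slope_incl p q g f a b"
    and g: "continuous_on {a..b} g" and x: "x \<in> {a<..<b}"
    and D: "(f has_vector_derivative D) (at x)"
    and M: "p * Re (c * g x) \<le> M" "q * Re (c * g x) \<le> M"
  shows "Re (c * D) \<le> M"
proof (rule field_le_epsilon)
  fix e' :: real assume "0 < e'"
  define e where "e = e' / 2"
  have e: "0 < e" "e' = e + e" using \<open>0 < e'\<close> by (auto simp: e_def)
  obtain d where d: "0 < d" and dq: "\<And>s t. a \<le> s \<Longrightarrow> s \<le> t \<Longrightarrow> t \<le> b \<Longrightarrow> x - d < s \<Longrightarrow> t < x + d \<Longrightarrow>
      Re (c * (f t - f s)) \<le> (M + e) * (t - s)"
    using slope_incl_difference_quotient_le[OF incl g, of x c "M + e"] M e x by auto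
  have c1: "0 < norm c + 1" by (simp add: add_nonneg_pos)
  have "0 < e / (norm c + 1)" using e c1 by simp
  then obtain r where r: "0 < r" and fr: "\<And>y. norm (y - x) < r \<Longrightarrow>
      norm (f y - f x - (y - x) *\<^sub>R D) \<le> e / (norm c + 1) * norm (y - x)"
    using D unfolding has_vector_derivative_def has_derivative_at_alt by blast
  define h where "h = Min {d, r, b - x} / 2"
  have h: "0 < h" "h < d" "h < r" "h < b - x" using d r x by (auto simp: h_def)
  have "norm (f (x + h) - f x - h *\<^sub>R D) \<le> e / (norm c + 1) * h"
    using fr[of "x + h"] h by simp
  then have "norm (- (c * (f (x + h) - f x - h *\<^sub>R D))) \<le> norm c * (e / (norm c + 1) * h)"
    unfolding norm_minus_cancel norm_mult by (rule mult_left_mono) simp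
  also have "\<dots> \<le> e * h"
  proof -
    have "norm c * e \<le> e * (norm c + 1)" using e by (simp add: algebra_simps)
    then have "norm c * (e / (norm c + 1)) \<le> e" using c1 by (simp add: divide_le_eq)
    from mult_right_mono[OF this, of h] show ?thesis using h by (simp add: mult.assoc)
  qed
  finally have "Re (- (c * (f (x + h) - f x - h *\<^sub>R D))) \<le> e * h"
    using complex_Re_le_cmod order_trans by blast
  moreover have "Re (- (c * (f (x + h) - f x - h *\<^sub>R D))) = h * Re (c * D) - Re (c * (f (x + h) - f x))"
    by (simp add: algebra_simps)
  moreover have "Re (c * (f (x + h) - f x)) \<le> (M + e) * h"
    using dq[of x "x + h"] x h by simp
  ultimately have "h * Re (c * D) \<le> h * (M + e')"
    by (simp add: algebra_simps e(2))
  then show "Re (c * D) \<le> M + e'" using h by simp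
qed

text \<open>The functionals given by \<open>c = 1, -1, \<i>, -\<i>\<close> suffice to confine \<open>D / g x\<close> to the real interval
\<open>[p, q]\<close>.\<close>

lemma slope_incl_derivative:
  assumes incl: "slope_incl p q g f a b" and pq: "p \<le> q"
    and g: "continuous_on {a..b} g" and x: "x \<in> {a<..<b}"
    and D: "(f has_vector_derivative D) (at x)"
  shows "\<exists>e. p \<le> e \<and> e \<le> q \<and> D = complex_of_real e * g x"
proof (cases "g x = 0")
  case True
  have le: "Re (c * D) \<le> 0" for c
    using slope_incl_derivative_le[OF incl g x D, of c 0] True by simp
  have "Re D = 0" "Im D = 0"
    using le[of 1] le[of "-1"] le[of \<i>] le[of "-\<i>"] by auto
  then have "D = 0" by (simp add: complex_eq_iff)
  then show ?thesis using True pq by auto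
next
  case False
  define w where "w = D / g x"
  have le: "Re (c * w) \<le> max (p * Re c) (q * Re c)" for c
    using slope_incl_derivative_le[OF incl g x D, of "c / g x" "max (p * Re c) (q * Re c)"] False
    by (simp add: w_def)
  have "Im w = 0" using le[of \<i>] le[of "-\<i>"] by simp
  moreover have "p \<le> Re w" "Re w \<le> q" using le[of 1] le[of "-1"] pq by auto
  ultimately show ?thesis
    using False by (intro exI[of _ "Re w"]) (auto simp: w_def complex_eq_iff[of "D / g x"] complex_is_Real_iff
      nonzero_eq_divide_eq[symmetric] of_real_Re)
qed

text \<open>The step that replaces weak compactness of the set of coefficients: only the increments of \<open>f\<close>
have to converge.\<close>

lemma slope_incl_limit:
  assumes incl: "\<And>n. slope_incl p q (G n) (F n) a b"
    and F: "\<And>t. t \<in> {a..b} \<Longrightarrow> (\<lambda>n. F n t) \<longlonglongrightarrow> f t"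
    and G: "uniform_limit {a..b} G g sequentially" and pq: "0 \<le> p" "p \<le> q"
  shows "slope_incl p q g f a b"
  unfolding slope_incl_def
proof (intro allI impI, elim conjE)
  fix s t c M
  assume st: "a \<le> s" "s \<le> t" "t \<le> b"
    and M: "\<forall>\<tau>\<in>{s..t}. p * Re (c * g \<tau>) \<le> M \<and> q * Re (c * g \<tau>) \<le> M"
  have "Re (c * (f t - f s)) \<le> (M + q * norm c * e) * (t - s)" if e: "0 < e" for e
  proof (rule tendsto_upperbound)
    show "(\<lambda>n. Re (c * (F n t - F n s))) \<longlonglongrightarrow> Re (c * (f t - f s))"
      using F[of t] F[of s] st by (intro tendsto_intros) auto
    show "\<forall>\<^sub>F n in sequentially. Re (c * (F n t - F n s)) \<le> (M + q * norm c * e) * (t - s)"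
      using uniform_limitD[OF G e]
    proof eventually_elim
      case (elim n)
      show ?case
      proof (rule slope_inclD[OF incl st])
        fix \<tau> assume \<tau>: "s \<le> \<tau>" "\<tau> \<le> t"
        have "Re (c * G n \<tau>) = Re (c * g \<tau>) + Re (c * (G n \<tau> - g \<tau>))" by (simp add: algebra_simps)
        also have "Re (c * (G n \<tau> - g \<tau>)) \<le> norm c * norm (G n \<tau> - g \<tau>)"
          by (metis complex_Re_le_cmod norm_mult)
        also have "\<dots> \<le> norm c * e"
          using elim \<tau> st by (intro mult_left_mono) (auto simp: dist_norm less_imp_le)
        finally have le: "Re (c * G n \<tau>) \<le> Re (c * g \<tau>) + norm c * e" by simp
        have "r * Re (c * G n \<tau>) \<le> M + q * norm c * e" if "0 \<le> r" "r \<le> q" "r * Re (c * g \<tau>) \<le> M" for r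
        proof -
          have "r * Re (c * G n \<tau>) \<le> r * Re (c * g \<tau>) + r * (norm c * e)"
            using mult_left_mono[OF le that(1)] by (simp add: distrib_left)
          also have "r * (norm c * e) \<le> q * (norm c * e)"
            using that e by (intro mult_right_mono) auto
          finally show ?thesis using that by (simp add: mult.assoc)
        qed
        then show "p * Re (c * G n \<tau>) \<le> M + q * norm c * e \<and> q * Re (c * G n \<tau>) \<le> M + q * norm c * e"
          using M \<tau> pq by auto
      qed
    qed
  qed auto
  then have *: "Re (c * (f t - f s)) \<le> M * (t - s) + (q * norm c * (t - s)) * e" if "0 < e" for e
    using that by (simp add: algebra_simps)
  define C where "C = q * norm c * (t - s)"
  have C: "0 \<le> C" using pq st by (simp add: C_def)
  show "Re (c * (f t - f s)) \<le> M * (t - s)"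
  proof (rule field_le_epsilon)
    fix e :: real assume "0 < e"
    have "Re (c * (f t - f s)) \<le> M * (t - s) + C * (e / (C + 1))"
      using *[of "e / (C + 1)"] \<open>0 < e\<close> C by (simp add: C_def)
    also have "C * (e / (C + 1)) \<le> e"
      using \<open>0 < e\<close> C by (simp add: field_simps)
    finally show "Re (c * (f t - f s)) \<le> M * (t - s) + e" by simp
  qed
qed

lemma slope_incl_concat:
  assumes "slope_incl p q g f a b" "slope_incl p q g f b c" 
  shows "slope_incl p q g f a c"
  unfolding slope_incl_def
proof (intro allI impI, elim conjE)
  fix s t k M
  assume st: "a \<le> s" "s \<le> t" "t \<le> c"
    and M: "\<forall>\<tau>\<in>{s..t}. p * Re (k * g \<tau>) \<le> M \<and> q * Re (k * g \<tau>) \<le> M"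
  have 1: "Re (k * (f v - f u)) \<le> M * (v - u)" if "s \<le> u" "u \<le> v" "v \<le> b" "v \<le> t" for u v
    by (rule slope_inclD[OF assms(1)]) (use that st M in auto)
  have 2: "Re (k * (f v - f u)) \<le> M * (v - u)" if "b \<le> u" "s \<le> u" "u \<le> v" "v \<le> t" for u v
    by (rule slope_inclD[OF assms(2)]) (use that st M in auto)
  consider "t \<le> b" | "b \<le> s" | "s \<le> b" "b \<le> t" by linarith
  then show "Re (k * (f t - f s)) \<le> M * (t - s)"
  proof cases
    case 3
    then have "Re (k * (f b - f s)) + Re (k * (f t - f b)) \<le> M * (b - s) + M * (t - b)"
      using 1[of s b] 2[of b t] by simp
    then show ?thesis by (simp add: algebra_simps)
  qed (use 1[of s t] 2[of s t] st in auto)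
qed

lemma slope_incl_cong:
  assumes "slope_incl p q g f a b"
    and "\<And>t. t \<in> {a..b} \<Longrightarrow> g' t = g t" "\<And>t. t \<in> {a..b} \<Longrightarrow> f' t = f t"
  shows "slope_incl p q g' f' a b"
  unfolding slope_incl_def
proof (intro allI impI, elim conjE)
  fix s t c M
  assume "a \<le> s" "s \<le> t" "t \<le> b" "\<forall>\<tau>\<in>{s..t}. p * Re (c * g' \<tau>) \<le> M \<and> q * Re (c * g' \<tau>) \<le> M"
  then show "Re (c * (f' t - f' s)) \<le> M * (t - s)"
    using slope_inclD[OF assms(1), of s t c M] assms(2,3) by simp
qed

lemma slope_incl_affine:
  assumes incl: "slope_incl p q g f (m * a + d) (m * b + d)" and m: "0 < m"
  shows "slope_incl p q (\<lambda>t. complex_of_real m * g (m * t + d)) (\<lambda>t. f (m * t + d)) a b"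
  unfolding slope_incl_def
proof (intro allI impI, elim conjE)
  fix s t c M
  assume st: "a \<le> s" "s \<le> t" "t \<le> b"
    and M: "\<forall>\<tau>\<in>{s..t}. p * Re (c * (complex_of_real m * g (m * \<tau> + d))) \<le> M \<and>
      q * Re (c * (complex_of_real m * g (m * \<tau> + d))) \<le> M"
  have "Re (c * (f (m * t + d) - f (m * s + d))) \<le> (M / m) * ((m * t + d) - (m * s + d))"
  proof (rule slope_inclD[OF incl])
    fix \<tau> assume "m * s + d \<le> \<tau>" "\<tau> \<le> m * t + d"
    then have "(\<tau> - d) / m \<in> {s..t}" "m * ((\<tau> - d) / m) + d = \<tau>"
      using m by (auto simp: field_simps)
    then have "p * Re (c * (complex_of_real m * g \<tau>)) \<le> M \<and> q * Re (c * (complex_of_real m * g \<tau>)) \<le> M"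
      using M by metis
    moreover have "Re (c * (complex_of_real m * g \<tau>)) = m * Re (c * g \<tau>)" by (simp add: algebra_simps)
    ultimately show "p * Re (c * g \<tau>) \<le> M / m \<and> q * Re (c * g \<tau>) \<le> M / m"
      using m by (simp add: field_simps)
  qed (use st m in auto)
  also have "\<dots> = M * (t - s)" using m by (simp add: field_simps)
  finally show "Re (c * (f (m * t + d) - f (m * s + d))) \<le> M * (t - s)" .
qed

lemma slope_incl_scale:
  assumes "slope_incl p q g f a b"
  shows "slope_incl p q (\<lambda>t. l * g t) (\<lambda>t. l * f t) a b"
  unfolding slope_incl_def
proof (intro allI impI, elim conjE)
  fix s t c M
  assume "a \<le> s" "s \<le> t" "t \<le> b"
    "\<forall>\<tau>\<in>{s..t}. p * Re (c * (l * g \<tau>)) \<le> M \<and> q * Re (c * (l * g \<tau>)) \<le> M"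
  then show "Re (c * (l * f t - l * f s)) \<le> M * (t - s)"
    using slope_inclD[OF assms, of s t "c * l" M] by (simp add: algebra_simps)
qed

lemma slope_incl_continuous:
  assumes incl: "slope_incl p q g f a b" and pq: "0 \<le> p" "p \<le> q"
    and K: "\<And>\<tau>. \<tau> \<in> {a..b} \<Longrightarrow> norm (g \<tau>) \<le> K"
  shows "continuous_on {a..b} f"
proof (rule lipschitz_on_continuous_on[of "q * \<bar>K\<bar>"], rule lipschitz_onI)
  fix s t assume st: "s \<in> {a..b}" "t \<in> {a..b}"
  have "norm (f t - f s) \<le> q * \<bar>K\<bar> * \<bar>t - s\<bar>"
    by (rule slope_incl_norm_le_abs[OF incl pq st]) (use K in fastforce)
  then show "dist (f s) (f t) \<le> q * \<bar>K\<bar> * dist s t"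
    by (simp add: dist_norm dist_real_def norm_minus_commute abs_minus_commute)
qed (use pq in auto)

text \<open>Subtracting the linear function with slope \<open>g x\<close> reduces this to the Lipschitz estimate with a
constant that is small near \<open>x\<close>.\<close>

lemma slope_incl_1_derivative:
  assumes incl: "slope_incl 1 1 g f a b" and g: "continuous_on {a..b} g" and x: "x \<in> {a..b}"
  shows "(f has_vector_derivative g x) (at x within {a..b})"
  unfolding has_vector_derivative_def has_derivative_within_alt
proof (intro conjI allI impI)
  fix e :: real assume e: "0 < e"
  obtain d where d: "0 < d" "\<And>t. t \<in> {a..b} \<Longrightarrow> dist t x < d \<Longrightarrow> dist (g t) (g x) < e"
    using g x e unfolding continuous_on_iff by metis
  show "\<exists>d>0. \<forall>y\<in>{a..b}. norm (y - x) < d \<longrightarrow>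
      norm (f y - f x - (y - x) *\<^sub>R g x) \<le> e * norm (y - x)"
  proof (intro exI[of _ d] conjI ballI impI d(1))
    fix y assume y: "y \<in> {a..b}" "norm (y - x) < d"
    define h where "h t = f t - t *\<^sub>R g x" for t
    have h: "slope_incl 1 1 (\<lambda>t. g t - g x) h a b"
      unfolding slope_incl_def
    proof (intro allI impI, elim conjE)
      fix s t c M
      assume st: "a \<le> s" "s \<le> t" "t \<le> b"
        and M: "\<forall>\<tau>\<in>{s..t}. 1 * Re (c * (g \<tau> - g x)) \<le> M \<and> 1 * Re (c * (g \<tau> - g x)) \<le> M"
      have "Re (c * (f t - f s)) \<le> (M + Re (c * g x)) * (t - s)"
      proof (rule slope_inclD[OF incl st])
        fix \<tau> assume "s \<le> \<tau>" "\<tau> \<le> t"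
        then have "Re (c * (g \<tau> - g x)) \<le> M" using M by auto
        then show "1 * Re (c * g \<tau>) \<le> M + Re (c * g x) \<and> 1 * Re (c * g \<tau>) \<le> M + Re (c * g x)"
          by (simp add: algebra_simps)
      qed
      then show "Re (c * (h t - h s)) \<le> M * (t - s)" by (simp add: h_def algebra_simps)
    qed
    have "norm (h (max x y) - h (min x y)) \<le> 1 * e * (max x y - min x y)"
    proof (rule slope_incl_norm_le[OF h])
      fix \<tau> assume "min x y \<le> \<tau>" "\<tau> \<le> max x y"
      then have "\<tau> \<in> {a..b}" "dist \<tau> x < d" using x y by (auto simp: dist_real_def)
      then show "norm (g \<tau> - g x) \<le> e" using d(2) by (simp add: dist_norm less_imp_le)
    qed (use x y in auto)
    then show "norm (f y - f x - (y - x) *\<^sub>R g x) \<le> e * norm (y - x)"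
      by (cases "x \<le> y") (auto simp: h_def max_def min_def algebra_simps norm_minus_commute)
  qed
qed (rule bounded_linear_scaleR_left)

section \<open>The wave equation as a first-order system\<close>

text \<open>With \<open>w = y' / (\<i> k)\<close> this is the equation \<open>y'' = - k\<^sup>2 \<epsilon> y\<close> for some unspecified coefficient with
values in \<open>[p, q]\<close>.\<close>

definition wave ::
  "real \<Rightarrow> real \<Rightarrow> complex \<Rightarrow> real \<Rightarrow> real \<Rightarrow> (real \<Rightarrow> complex) \<Rightarrow> (real \<Rightarrow> complex) \<Rightarrow> bool" where
  "wave p q k a b y w \<longleftrightarrow> continuous_on {a..b} y \<and> continuous_on {a..b} w \<and>
     slope_incl 1 1 (\<lambda>t. \<i> * k * w t) y a b \<and> slope_incl p q (\<lambda>t. \<i> * k * y t) w a b"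

lemma wave_increment_le:
  assumes wave: "wave p q k a b y w" and pq: "0 \<le> p" "p \<le> q" and st: "a \<le> s" "s \<le> t" "t \<le> b"
    and R: "\<And>\<tau>. s \<le> \<tau> \<Longrightarrow> \<tau> \<le> t \<Longrightarrow> norm (y \<tau>) + norm (w \<tau>) \<le> R"
  shows "norm (y t - y s) \<le> norm k * R * (t - s)"
    and "norm (w t - w s) \<le> q * (norm k * R) * (t - s)"
proof -
  have R': "norm (\<i> * k * w \<tau>) \<le> norm k * R" "norm (\<i> * k * y \<tau>) \<le> norm k * R"
    if "s \<le> \<tau>" "\<tau> \<le> t" for \<tau>
  proof -
    have "norm (w \<tau>) \<le> R" "norm (y \<tau>) \<le> R"
      using R[OF that] norm_ge_zero[of "y \<tau>"] norm_ge_zero[of "w \<tau>"] by linarith+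
    then show "norm (\<i> * k * w \<tau>) \<le> norm k * R" "norm (\<i> * k * y \<tau>) \<le> norm k * R"
      by (auto simp: norm_mult mult_left_mono)
  qed
  show "norm (y t - y s) \<le> norm k * R * (t - s)"
    using slope_incl_norm_le[of 1 1 "\<lambda>t. \<i> * k * w t" y a b s t "norm k * R"] wave st R'
    by (simp add: wave_def)
  show "norm (w t - w s) \<le> q * (norm k * R) * (t - s)"
    using slope_incl_norm_le[of p q "\<lambda>t. \<i> * k * y t" w a b s t "norm k * R"] wave st R' pq
    by (simp add: wave_def)
qed

text \<open>Within distance \<open>h\<close> of a zero of the state, the maximum of \<open>|y| + |w|\<close> is at most half of itself.\<close>

lemma wave_zero_locally:
  assumes wave: "wave p q k a b y w" and pq: "0 \<le> p" "p \<le> q"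
    and t: "t \<in> {a..b}" "y t = 0" "w t = 0"
    and h: "0 \<le> h" "(1 + q) * norm k * h \<le> 1 / 2" and s: "s \<in> {a..b}" "\<bar>s - t\<bar> \<le> h"
  shows "y s = 0 \<and> w s = 0"
proof -
  define N where "N \<tau> = norm (y \<tau>) + norm (w \<tau>)" for \<tau>
  define I where "I = {max a (t - h)..min b (t + h)}"
  have I: "I \<subseteq> {a..b}" "t \<in> I" "s \<in> I" using t s h by (auto simp: I_def)
  have "continuous_on I N"
    using wave continuous_on_subset[OF _ I(1)] unfolding N_def wave_def
    by (intro continuous_intros) auto
  moreover have "compact I" "I \<noteq> {}" using I by (auto simp: I_def)
  ultimately obtain x where x: "x \<in> I" "\<And>\<tau>. \<tau> \<in> I \<Longrightarrow> N \<tau> \<le> N x"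
    using continuous_attains_sup[of I N] by blast
  define u v where "u = min t x" and "v = max t x"
  have uv: "a \<le> u" "u \<le> v" "v \<le> b" "v - u \<le> h" using x(1) I(1,2) by (auto simp: u_def v_def I_def)
  have bd: "norm (y \<tau>) + norm (w \<tau>) \<le> N x" if "u \<le> \<tau>" "\<tau> \<le> v" for \<tau>
    using x(2)[of \<tau>] that x(1) I(2) by (auto simp: u_def v_def I_def N_def min_def max_def split: if_splits)
  have N0: "0 \<le> N x" by (simp add: N_def)
  have "N x = norm (y v - y u) + norm (w v - w u)"
    using t by (auto simp: N_def u_def v_def min_def max_def)
  also have "\<dots> \<le> norm k * N x * (v - u) + q * (norm k * N x) * (v - u)"
    using wave_increment_le[OF wave pq uv(1-3) bd] by (intro add_mono) auto
  also have "\<dots> = (1 + q) * norm k * N x * (v - u)" by (simp add: algebra_simps)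
  also have "\<dots> \<le> (1 + q) * norm k * N x * h"
    using uv N0 pq by (intro mult_left_mono) auto
  also have "\<dots> = ((1 + q) * norm k * h) * N x" by simp
  also have "\<dots> \<le> 1 / 2 * N x" using h N0 by (intro mult_right_mono)
  finally have "N x = 0" using N0 by simp
  then have "N s \<le> 0" using x(2)[OF I(3)] by simp
  then show ?thesis
    unfolding N_def using norm_ge_zero[of "y s"] norm_ge_zero[of "w s"]
    by (metis add_nonneg_eq_0_iff antisym add_nonneg_nonneg norm_eq_zero)
qed

text \<open>By the local statement, the set of zeros of the state is open in \<open>[a, b]\<close>; it is also closed, and
the interval is connected.\<close>

lemma wave_zero_unique:
  assumes wave: "wave p q k a b y w" and pq: "0 \<le> p" "p \<le> q"
    and t: "t \<in> {a..b}" "y t = 0" "w t = 0" and s: "s \<in> {a..b}"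
  shows "y s = 0 \<and> w s = 0"
proof -
  \<comment> \<open>The added 1 keeps \<open>h\<close> positive also for \<open>k = 0\<close>.\<close>
  define h where "h = 1 / (2 * ((1 + q) * norm k + 1))"
  have "0 \<le> (1 + q) * norm k" using pq by simp
  then have h: "0 < h" "(1 + q) * norm k * h \<le> 1 / 2"
    by (auto simp: h_def field_simps add_nonneg_pos)
  define Z where "Z = {x \<in> {a..b}. y x = 0 \<and> w x = 0}"
  have "openin (top_of_set {a..b}) Z"
    unfolding openin_euclidean_subtopology_iff
  proof (intro conjI ballI)
    fix x assume x: "x \<in> Z"
    show "\<exists>e>0. \<forall>x'\<in>{a..b}. dist x' x < e \<longrightarrow> x' \<in> Z"
    proof (intro exI[of _ h] conjI ballI impI h(1))
      fix x' assume "x' \<in> {a..b}" "dist x' x < h"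
      then show "x' \<in> Z"
        using wave_zero_locally[OF wave pq, of x h x'] x h by (auto simp: Z_def dist_real_def)
    qed
  qed (auto simp: Z_def)
  moreover have "closedin (top_of_set {a..b}) Z"
  proof -
    have Z: "Z = {x \<in> {a..b}. y x = 0} \<inter> {x \<in> {a..b}. w x = 0}" by (auto simp: Z_def)
    have "continuous_on {a..b} y" "continuous_on {a..b} w" using wave by (simp_all add: wave_def)
    then show ?thesis
      unfolding Z by (intro closedin_Int continuous_closedin_preimage_constant)
  qed
  moreover have "t \<in> Z" using t by (simp add: Z_def)
  moreover have "\<forall>T. openin (top_of_set {a..b}) T \<and> closedin (top_of_set {a..b}) T \<longrightarrow> T = {} \<or> T = {a..b}"
    using connected_Icc[of a b] unfolding connected_clopen .
  ultimately have "Z = {a..b}" by auto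
  then have "s \<in> Z" using s by (simp only:)
  then show ?thesis by (simp add: Z_def)
qed

lemma wave_scale:
  assumes "wave p q k a b y w"
  shows "wave p q k a b (\<lambda>t. l * y t) (\<lambda>t. l * w t)"
proof -
  have "slope_incl 1 1 (\<lambda>t. \<i> * k * (l * w t)) (\<lambda>t. l * y t) a b"
    using slope_incl_scale[of 1 1 "\<lambda>t. \<i> * k * w t" y a b l] assms
    by (simp add: wave_def mult.left_commute)
  moreover have "slope_incl p q (\<lambda>t. \<i> * k * (l * y t)) (\<lambda>t. l * w t) a b"
    using slope_incl_scale[of p q "\<lambda>t. \<i> * k * y t" w a b l] assms
    by (simp add: wave_def mult.left_commute)
  ultimately show ?thesis
    using assms unfolding wave_def by (auto intro!: continuous_intros)
qed

lemma wave_affine: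
  assumes wave: "wave p q k (m * a + d) (m * b + d) y w" and m: "0 < m"
  shows "wave p q (complex_of_real m * k) a b (\<lambda>t. y (m * t + d)) (\<lambda>t. w (m * t + d))"
proof -
  have im: "(\<lambda>t. m * t + d) ` {a..b} \<subseteq> {m * a + d..m * b + d}" using m by auto
  have "continuous_on {a..b} (\<lambda>t. f (m * t + d))" if "continuous_on {m * a + d..m * b + d} f"
    for f :: "real \<Rightarrow> complex"
    by (rule continuous_on_compose2[OF that _ im]) (intro continuous_intros)
  moreover have "slope_incl 1 1 (\<lambda>t. \<i> * (complex_of_real m * k) * w (m * t + d)) (\<lambda>t. y (m * t + d)) a b"
    using slope_incl_affine[OF _ m, of 1 1 "\<lambda>t. \<i> * k * w t" y a d b] wave
    by (simp add: wave_def mult_ac)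
  moreover have "slope_incl p q (\<lambda>t. \<i> * (complex_of_real m * k) * y (m * t + d)) (\<lambda>t. w (m * t + d)) a b"
    using slope_incl_affine[OF _ m, of p q "\<lambda>t. \<i> * k * y t" w a d b] wave
    by (simp add: wave_def mult_ac)
  ultimately show ?thesis using wave unfolding wave_def by blast
qed

lemma wave_concat:
  assumes 1: "wave p q k a b y1 w1" and 2: "wave p q k b c y2 w2"
    and eq: "y1 b = y2 b" "w1 b = w2 b" and le: "a \<le> b" "b \<le> c"
  shows "wave p q k a c (\<lambda>t. if t \<le> b then y1 t else y2 t) (\<lambda>t. if t \<le> b then w1 t else w2 t)"
    (is "wave p q k a c ?y ?w")
proof -
  have un: "{a..c} = {a..b} \<union> {b..c}" using le by auto
  have cont: "continuous_on {a..c} (\<lambda>t. if t \<le> b then f1 t else f2 t)"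
    if "continuous_on {a..b} f1" "continuous_on {b..c} f2" "f1 b = f2 b" for f1 f2 :: "real \<Rightarrow> complex"
    unfolding un using that by (intro continuous_on_cases) auto
  have incl: "slope_incl p' q' (\<lambda>t. \<i> * k * (if t \<le> b then g1 t else g2 t)) (\<lambda>t. if t \<le> b then f1 t else f2 t) a c"
    if "slope_incl p' q' (\<lambda>t. \<i> * k * g1 t) f1 a b" "slope_incl p' q' (\<lambda>t. \<i> * k * g2 t) f2 b c"
      "f1 b = f2 b" "g1 b = g2 b" for p' q' f1 f2 g1 g2
  proof (rule slope_incl_concat[of _ _ _ _ a b c])
    show "slope_incl p' q' (\<lambda>t. \<i> * k * (if t \<le> b then g1 t else g2 t)) (\<lambda>t. if t \<le> b then f1 t else f2 t) a b"
      by (rule slope_incl_cong[OF that(1)]) auto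
    show "slope_incl p' q' (\<lambda>t. \<i> * k * (if t \<le> b then g1 t else g2 t)) (\<lambda>t. if t \<le> b then f1 t else f2 t) b c"
      by (rule slope_incl_cong[OF that(2)]) (use that(3,4) in auto)
  qed
  show ?thesis
    using assms unfolding wave_def by (auto intro!: cont incl)
qed

lemma slope_incl_scaled_slope:
  assumes incl: "slope_incl 1 1 (\<lambda>t. complex_of_real e * g t) f a b" and e: "p \<le> e" "e \<le> q"
  shows "slope_incl p q g f a b"
  unfolding slope_incl_def
proof (intro allI impI, elim conjE)
  fix s t c M
  assume st: "a \<le> s" "s \<le> t" "t \<le> b"
    and M: "\<forall>\<tau>\<in>{s..t}. p * Re (c * g \<tau>) \<le> M \<and> q * Re (c * g \<tau>) \<le> M"
  show "Re (c * (f t - f s)) \<le> M * (t - s)"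
  proof (rule slope_inclD[OF incl st])
    fix \<tau> assume "s \<le> \<tau>" "\<tau> \<le> t"
    then have "\<tau> \<in> {s..t}" by simp
    note M' = bspec[OF M this]
    have "e * Re (c * g \<tau>) \<le> M"
      by (rule scaled_le_if_endpoints_le[OF conjunct1[OF M'] conjunct2[OF M'] e])
    moreover have "Re (c * (complex_of_real e * g \<tau>)) = e * Re (c * g \<tau>)"
      by (simp add: algebra_simps)
    ultimately show "1 * Re (c * (complex_of_real e * g \<tau>)) \<le> M \<and>
        1 * Re (c * (complex_of_real e * g \<tau>)) \<le> M" by simp
  qed
qed

text \<open>Under the constant coefficient \<open>n\<^sup>2\<close> the combinations \<open>w + n y\<close> and \<open>w - n y\<close> solve scalar
equations; they equal \<open>P e\<close> and \<open>M / e\<close>.\<close>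

lemma wave_constant_coefficient:
  assumes n: "p \<le> n\<^sup>2" "n\<^sup>2 \<le> q" "n \<noteq> 0"
    and e_def: "\<And>t. e t = exp (\<i> * k * complex_of_real n * complex_of_real t)"
  shows "wave p q k a b (\<lambda>t. (P * e t - M / e t) / (2 * complex_of_real n)) (\<lambda>t. (P * e t + M / e t) / 2)"
    (is "wave p q k a b ?y ?w")
proof -
  have einv: "M / e t = M * exp (- (\<i> * k * complex_of_real n * complex_of_real t))" for t
    by (simp add: e_def exp_minus field_simps)
  have dy: "(?y has_vector_derivative \<i> * k * ?w t) (at t within T)" for t T
    unfolding einv unfolding e_def
    by (rule has_vector_derivative_real_field, insert n(3))
      (auto intro!: derivative_eq_intros simp: field_simps)
  have dw: "(?w has_vector_derivative complex_of_real (n\<^sup>2) * (\<i> * k * ?y t)) (at t within T)" for t T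
    unfolding einv unfolding e_def
    by (rule has_vector_derivative_real_field, insert n(3))
      (auto intro!: derivative_eq_intros simp: field_simps power2_eq_square)
  have cont: "continuous_on {a..b} ?y" "continuous_on {a..b} ?w"
    by (rule continuous_on_vector_derivative, rule dy) (rule continuous_on_vector_derivative, rule dw)
  have "slope_incl 1 1 (\<lambda>t. complex_of_real (n\<^sup>2) * (\<i> * k * ?y t)) ?w a b"
    using dw by (rule slope_incl_if_derivative)
  then have "slope_incl p q (\<lambda>t. \<i> * k * ?y t) ?w a b"
    by (rule slope_incl_scaled_slope[OF _ n(1,2)])
  then show ?thesis
    unfolding wave_def using cont slope_incl_if_derivative[OF dy] by blast
qed

lemma has_vector_derivative_imp_tendsto:
  assumes "(f has_vector_derivative D) (at x)"
  shows "((\<lambda>h. (f (x + h) - f x) /\<^sub>R h) \<longlongrightarrow> D) (at 0)"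
proof -
  have "(\<lambda>h. norm (f (x + h) - f x - h *\<^sub>R D) / norm h) \<midarrow>0\<rightarrow> 0"
    using assms unfolding has_vector_derivative_def has_derivative_at by (rule conjunct2)
  moreover have "\<forall>\<^sub>F h in at 0. norm (f (x + h) - f x - h *\<^sub>R D) / norm h
      = norm ((f (x + h) - f x) /\<^sub>R h - D)"
  proof (rule eventually_at_topological[THEN iffD2], intro exI[of _ UNIV] conjI ballI impI)
    fix h :: real assume "h \<noteq> 0"
    then have "(f (x + h) - f x) /\<^sub>R h - D = (f (x + h) - f x - h *\<^sub>R D) /\<^sub>R h"
      by (simp add: scaleR_diff_right)
    then show "norm (f (x + h) - f x - h *\<^sub>R D) / norm h = norm ((f (x + h) - f x) /\<^sub>R h - D)"
      by (simp add: divide_inverse mult.commute)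
  qed auto
  ultimately have "((\<lambda>h. norm ((f (x + h) - f x) /\<^sub>R h - D)) \<longlongrightarrow> 0) (at 0)"
    by (rule Lim_transform_eventually)
  then show ?thesis by (simp add: tendsto_norm_zero_iff LIM_zero_iff)
qed

text \<open>At almost every point \<open>w\<close> has a derivative, which must be \<open>\<i> k y\<close> times a number in \<open>[n1\<^sup>2, n2\<^sup>2]\<close>.
Where \<open>y\<close> does not vanish, this number is recovered as a limit of measurable difference quotients;
where \<open>y\<close> vanishes, both sides are 0 and any value will do.\<close>

lemma wave_imp_solution:
  assumes wave: "wave (n1\<^sup>2) (n2\<^sup>2) k a b y w" and n: "0 < n1" "n1 < n2" and ab: "a < b" and k: "k \<noteq> 0"
  shows "\<exists>\<epsilon>\<in>admissible n1 n2 a b. is_solution \<epsilon> k a b y (\<lambda>t. \<i> * k * w t)"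
proof -
  have pq: "0 \<le> n1\<^sup>2" "n1\<^sup>2 \<le> n2\<^sup>2" using n by (auto intro: power_mono)
  have cont: "continuous_on {a..b} y" "continuous_on {a..b} w" using wave by (auto simp: wave_def)
  have "bounded (y ` {a..b})" using cont(1) by (intro compact_imp_bounded compact_continuous_image) auto
  then obtain R where R: "\<And>t. t \<in> {a..b} \<Longrightarrow> norm (y t) \<le> R"
    unfolding bounded_iff by blast
  define L where "L = n2\<^sup>2 * (norm k * R)"
  have Lw: "norm (w t - w s) \<le> L * \<bar>t - s\<bar>" if "s \<in> {a..b}" "t \<in> {a..b}" for s t
    unfolding L_def
    by (rule slope_incl_norm_le_abs[of "n1\<^sup>2" _ "\<lambda>t. \<i> * k * y t" _ a b])
      (use wave pq that R in \<open>auto simp: wave_def norm_mult mult_left_mono\<close>)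
  have L0: "0 \<le> L"
    using order_trans[OF norm_ge_zero R[of a]] ab unfolding L_def by (intro mult_nonneg_nonneg) auto
  \<comment> \<open>Constant continuation beyond \<open>{a..b}\<close>, so that the differentiability
      theorem for functions on the whole line applies.\<close>
  define clamp where "clamp t = max a (min b t)" for t
  have clamp: "clamp t \<in> {a..b}" for t using ab by (auto simp: clamp_def)
  define W Y where "W t = w (clamp t)" and "Y t = y (clamp t)" for t
  have LW: "norm (W t - W s) \<le> L * \<bar>t - s\<bar>" for s t
  proof -
    have "norm (W t - W s) \<le> L * \<bar>clamp t - clamp s\<bar>"
      unfolding W_def by (rule Lw) (rule clamp)+
    also have "\<dots> \<le> L * \<bar>t - s\<bar>" using L0 by (intro mult_left_mono) (auto simp: clamp_def)
    finally show ?thesis .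
  qed
  have contWY: "continuous_on UNIV W" "continuous_on UNIV Y"
    unfolding W_def Y_def
    by (rule continuous_on_compose2[OF cont(2), of UNIV clamp] continuous_on_compose2[OF cont(1), of UNIV clamp];
      use clamp in \<open>auto simp: clamp_def intro!: continuous_intros\<close>)+
  define Q where "Q n t = real (Suc n) *\<^sub>R (W (t + 1 / real (Suc n)) - W t)" for n t
  \<comment> \<open>On \<open>(a, b)\<close> the truncation has an effect only where \<open>y\<close>
      vanishes and on the null set where \<open>w\<close> is not differentiable.\<close>
  define \<epsilon> where "\<epsilon> t = max (n1\<^sup>2) (min (n2\<^sup>2) (Re (lim (\<lambda>n. Q n t) / (\<i> * k * Y t))))" for t
  have "Q n \<in> borel_measurable borel" for n
    unfolding Q_def
    by (intro borel_measurable_continuous_onI continuous_intros continuous_on_compose2[OF contWY(1)]) auto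
  then have "(\<lambda>t. lim (\<lambda>n. Q n t)) \<in> borel_measurable borel"
    by (rule borel_measurable_lim_metric)
  moreover have "Y \<in> borel_measurable borel"
    by (rule borel_measurable_continuous_onI[OF contWY(2)])
  ultimately have "\<epsilon> \<in> borel_measurable borel"
    unfolding \<epsilon>_def by measurable
  then have "\<epsilon> \<in> borel_measurable (lebesgue_on {a<..<b})"
    by (intro measurable_restrict_space1 measurable_completion) simp
  moreover have "n1\<^sup>2 \<le> \<epsilon> t \<and> \<epsilon> t \<le> n2\<^sup>2" for t using pq by (auto simp: \<epsilon>_def)
  ultimately have adm: "\<epsilon> \<in> admissible n1 n2 a b"
    by (simp add: admissible_def)
  let ?N = "{x. \<nexists>D. (W has_vector_derivative D) (at x)}"
  have N: "negligible ?N" using LW by (rule Lipschitz_imp_AE_differentiable_complex)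
  have der: "((\<lambda>t. \<i> * k * w t) has_vector_derivative - k\<^sup>2 * complex_of_real (\<epsilon> x) * y x) (at x)"
    if x: "x \<in> {a<..<b} - ?N" for x
  proof -
    obtain D where D: "(W has_vector_derivative D) (at x)" using x by auto
    have w: "(w has_vector_derivative D) (at x)"
      by (rule has_vector_derivative_transform_within_open[OF D, of "{a<..<b}"])
        (use x in \<open>auto simp: W_def clamp_def min_def max_def\<close>)
    have "continuous_on {a..b} (\<lambda>t. \<i> * k * y t)" using cont by (intro continuous_intros)
    then obtain e where e: "n1\<^sup>2 \<le> e" "e \<le> n2\<^sup>2" "D = complex_of_real e * (\<i> * k * y x)"
      using slope_incl_derivative[of "n1\<^sup>2" "n2\<^sup>2" "\<lambda>t. \<i> * k * y t" w a b x D] wave w pq x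
      by (auto simp: wave_def)
    have Yx: "Y x = y x" using x by (simp add: Y_def clamp_def)
    have "D = complex_of_real (\<epsilon> x) * (\<i> * k * y x)"
    proof (cases "y x = 0")
      case False
      have "(\<lambda>n. Q n x) \<longlonglongrightarrow> D"
      proof -
        have lim: "((\<lambda>h. (W (x + h) - W x) /\<^sub>R h) \<longlongrightarrow> D) (at 0)"
          using D by (rule has_vector_derivative_imp_tendsto)
        have "(\<lambda>n. 1 / real (Suc n)) \<longlonglongrightarrow> 0" by (rule LIMSEQ_Suc[OF lim_1_over_n])
        then have "filterlim (\<lambda>n. 1 / real (Suc n)) (at 0) sequentially"
          by (simp add: filterlim_at)
        from filterlim_compose[OF lim this] show ?thesis by (simp add: Q_def[abs_def])
      qed
      then have "lim (\<lambda>n. Q n x) = D" by (rule limI)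
      then have "\<epsilon> x = e" using e False k by (simp add: \<epsilon>_def Yx)
      then show ?thesis using e by simp
    qed (use e in simp)
    then have "((\<lambda>t. \<i> * k * w t) has_vector_derivative \<i> * k * (complex_of_real (\<epsilon> x) * (\<i> * k * y x))) (at x)"
      using w by (intro has_vector_derivative_mult_right) simp
    moreover have "\<i> * k * (complex_of_real (\<epsilon> x) * (\<i> * k * y x)) = - k\<^sup>2 * complex_of_real (\<epsilon> x) * y x"
      by (simp add: power2_eq_square algebra_simps)
    ultimately show ?thesis by simp
  qed
  have "is_solution \<epsilon> k a b y (\<lambda>t. \<i> * k * w t)"
    unfolding is_solution_def
  proof (intro conjI ballI)
    show "(y has_vector_derivative \<i> * k * w t) (at t within {a..b})" if "t \<in> {a..b}" for t
    proof (rule slope_incl_1_derivative)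
      show "slope_incl 1 1 (\<lambda>t. \<i> * k * w t) y a b" using wave by (simp add: wave_def)
      show "continuous_on {a..b} (\<lambda>t. \<i> * k * w t)" using cont by (intro continuous_intros)
    qed (rule that)
    show "abs_cont_on {a..b} (\<lambda>t. \<i> * k * w t)"
    proof (rule Lipschitz_imp_abs_cont_on[of _ _ _ "norm k * L"])
      fix s t assume "s \<in> {a..b}" "t \<in> {a..b}"
      from mult_left_mono[OF Lw[OF this], of "norm k"]
      show "norm (\<i> * k * w t - \<i> * k * w s) \<le> norm k * L * \<bar>t - s\<bar>"
        by (simp add: norm_mult right_diff_distrib[symmetric] mult.assoc)
    qed
    have "AE t in lebesgue. t \<in> {a<..<b} \<longrightarrow>
        ((\<lambda>t. \<i> * k * w t) has_vector_derivative - k\<^sup>2 * complex_of_real (\<epsilon> t) * y t) (at t)"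
      by (rule AE_I'[of ?N]) (use N der in \<open>auto simp: negligible_iff_null_sets\<close>)
    then show "AE t in lebesgue_on {a<..<b}.
        ((\<lambda>t. \<i> * k * w t) has_vector_derivative - k\<^sup>2 * complex_of_real (\<epsilon> t) * y t) (at t)"
      by (rule AE_restrict_space_iff[THEN iffD2, rotated]) simp
  qed
  then show ?thesis using adm by blast
qed

lemma solution_imp_wave:
  assumes \<epsilon>: "\<epsilon> \<in> admissible n1 n2 a b" and sol: "is_solution \<epsilon> k a b y z"
    and n: "0 < n1" "n1 < n2" and k: "k \<noteq> 0"
  shows "wave (n1\<^sup>2) (n2\<^sup>2) k a b y (\<lambda>t. z t / (\<i> * k))"
proof -
  have pq: "0 \<le> n1\<^sup>2" "n1\<^sup>2 \<le> n2\<^sup>2" using n by (auto intro: power_mono)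
  have dy: "(y has_vector_derivative z t) (at t within {a..b})" if "t \<in> {a..b}" for t
    using sol that by (simp add: is_solution_def)
  have conty: "continuous_on {a..b} y"
    using dy by (rule continuous_on_vector_derivative)
  have "AE t in lebesgue_on {a<..<b}. n1\<^sup>2 \<le> \<epsilon> t \<and> \<epsilon> t \<le> n2\<^sup>2 \<and>
      (z has_vector_derivative - k\<^sup>2 * complex_of_real (\<epsilon> t) * y t) (at t)"
    using \<epsilon> sol unfolding admissible_def is_solution_def by auto
  then have "AE t in lebesgue. t \<in> {a<..<b} \<longrightarrow> n1\<^sup>2 \<le> \<epsilon> t \<and> \<epsilon> t \<le> n2\<^sup>2 \<and>
      (z has_vector_derivative - k\<^sup>2 * complex_of_real (\<epsilon> t) * y t) (at t)"
    by (rule AE_restrict_space_iff[THEN iffD1, rotated]) simp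
  then obtain N where N: "N \<in> null_sets lebesgue" and ode: "\<And>t. t \<in> {a<..<b} - N \<Longrightarrow>
      n1\<^sup>2 \<le> \<epsilon> t \<and> \<epsilon> t \<le> n2\<^sup>2 \<and> (z has_vector_derivative - k\<^sup>2 * complex_of_real (\<epsilon> t) * y t) (at t)"
    unfolding eventually_ae_filter by fastforce
  have z: "slope_incl (n1\<^sup>2) (n2\<^sup>2) (\<lambda>t. - k\<^sup>2 * y t) z a b"
  proof (rule slope_incl_if_abs_cont)
    show "abs_cont_on {a..b} z" using sol by (simp add: is_solution_def)
    show "negligible N" using N by (simp add: negligible_iff_null_sets)
    fix x assume "x \<in> {a<..<b} - N"
    from ode[OF this] show "\<exists>e\<ge>n1\<^sup>2. e \<le> n2\<^sup>2 \<and>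
        (z has_vector_derivative complex_of_real e * (- k\<^sup>2 * y x)) (at x)"
      by (intro exI[of _ "\<epsilon> x"]) (simp add: mult_ac)
  qed (rule pq)
  have "bounded ((\<lambda>t. - k\<^sup>2 * y t) ` {a..b})"
    using conty by (intro compact_imp_bounded compact_continuous_image continuous_intros) auto
  then obtain R where "\<And>t. t \<in> {a..b} \<Longrightarrow> norm (- k\<^sup>2 * y t) \<le> R"
    unfolding bounded_iff by blast
  then have contz: "continuous_on {a..b} z" using slope_incl_continuous[OF z pq] by blast
  have "slope_incl (n1\<^sup>2) (n2\<^sup>2) (\<lambda>t. 1 / (\<i> * k) * (- k\<^sup>2 * y t)) (\<lambda>t. 1 / (\<i> * k) * z t) a b"
    using z by (rule slope_incl_scale)
  moreover have "1 / (\<i> * k) * (- k\<^sup>2 * y t) = \<i> * k * y t" for t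
    using k by (simp add: field_simps power2_eq_square)
  ultimately have "slope_incl (n1\<^sup>2) (n2\<^sup>2) (\<lambda>t. \<i> * k * y t) (\<lambda>t. z t / (\<i> * k)) a b"
    by simp
  moreover have "slope_incl 1 1 (\<lambda>t. \<i> * k * (z t / (\<i> * k))) y a b"
    using slope_incl_if_derivative[OF dy] k by simp
  moreover have "continuous_on {a..b} (\<lambda>t. z t / (\<i> * k))"
    using contz k by (intro continuous_intros) auto
  ultimately show ?thesis unfolding wave_def using conty by blast
qed

section \<open>Resonances as waves\<close>

text \<open>The closure of \<open>boundary_cond\<close>, which excludes \<open>u = 0\<close> for finite \<open>\<eta>\<close>; a closed condition passes to
limits, and for nontrivial waves the two agree by uniqueness.\<close>

definition left_cond :: "ereal \<Rightarrow> complex \<Rightarrow> complex \<Rightarrow> bool" where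
  "left_cond \<eta> u w \<longleftrightarrow> (if \<bar>\<eta>\<bar> = \<infinity> then u = 0 else w = complex_of_real (real_of_ereal \<eta>) * u)"

definition resonant_wave ::
  "real \<Rightarrow> real \<Rightarrow> ereal \<Rightarrow> real \<Rightarrow> complex \<Rightarrow> real \<Rightarrow> (real \<Rightarrow> complex) \<Rightarrow> (real \<Rightarrow> complex) \<Rightarrow> bool" where
  "resonant_wave p q \<eta>m \<eta>p k L y w \<longleftrightarrow> wave p q k 0 L y w \<and> left_cond \<eta>m (y 0) (w 0) \<and>
     w L = complex_of_real \<eta>p * y L \<and> (\<exists>t\<in>{0..L}. (y t, w t) \<noteq> 0)"

lemma resonant_wave_endpoints:
  assumes res: "resonant_wave p q \<eta>m \<eta>p k L y w" and pq: "0 \<le> p" "p \<le> q"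
  shows "y L \<noteq> 0" and "(y 0, w 0) \<noteq> 0"
proof -
  obtain t where t: "t \<in> {0..L}" "(y t, w t) \<noteq> 0" and wave: "wave p q k 0 L y w"
    and right: "w L = complex_of_real \<eta>p * y L"
    using res by (auto simp: resonant_wave_def)
  have zero: False if "s \<in> {0..L}" "y s = 0" "w s = 0" for s
    using wave_zero_unique[OF wave pq that t(1)] t(2) by (simp add: zero_prod_def)
  show "y L \<noteq> 0" using zero[of L] right t(1) by auto
  show "(y 0, w 0) \<noteq> 0" using zero[of 0] t(1) by (auto simp: zero_prod_def)
qed

lemma boundary_cond_iff:
  assumes "k \<noteq> 0"
  shows "boundary_cond \<eta> k u (\<i> * k * w) \<longleftrightarrow>
    left_cond \<eta> u w \<and> (\<bar>\<eta>\<bar> \<noteq> \<infinity> \<longrightarrow> u \<noteq> 0)"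
proof -
  have "\<i> * k * w / (\<i> * k * u) = w / u" using assms by simp
  then show ?thesis
    unfolding boundary_cond_def left_cond_def by (auto simp: field_simps)
qed

text \<open>The right-hand side no longer mentions a coefficient, and its boundary conditions are linear
equations; both properties are what the limit and concatenation arguments rely on.\<close>

theorem achievable_iff:
  assumes n: "0 < n1" "n1 < n2" and ab: "a < b"
  shows "k \<in> achievable n1 n2 a b \<eta>m (ereal \<eta>p) \<longleftrightarrow>
    k \<noteq> 0 \<and> (\<exists>y w. resonant_wave (n1\<^sup>2) (n2\<^sup>2) \<eta>m \<eta>p k (b - a) y w)"
proof
  assume "k \<in> achievable n1 n2 a b \<eta>m (ereal \<eta>p)"
  then obtain \<epsilon> y z t where \<epsilon>: "\<epsilon> \<in> admissible n1 n2 a b" and k: "k \<noteq> 0"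
    and sol: "is_solution \<epsilon> k a b y z" and t: "t \<in> {a<..<b}" "y t \<noteq> 0"
    and bc: "boundary_cond \<eta>m k (y a) (z a)" "boundary_cond (ereal \<eta>p) k (y b) (z b)"
    by (auto simp: achievable_def resonances_def)
  define w where "w t = z t / (\<i> * k)" for t
  have zw: "z t = \<i> * k * w t" for t using k by (simp add: w_def)
  have "wave (n1\<^sup>2) (n2\<^sup>2) k a b y w"
    unfolding w_def by (rule solution_imp_wave[OF \<epsilon> sol n k])
  then have "wave (n1\<^sup>2) (n2\<^sup>2) k 0 (b - a) (\<lambda>t. y (t + a)) (\<lambda>t. w (t + a))"
    using wave_affine[of "n1\<^sup>2" "n2\<^sup>2" k 1 0 a "b - a" y w] by simp
  moreover have "left_cond \<eta>m (y a) (w a)" "w b = complex_of_real \<eta>p * y b"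
    using bc boundary_cond_iff[OF k] by (auto simp: zw left_cond_def)
  ultimately have "resonant_wave (n1\<^sup>2) (n2\<^sup>2) \<eta>m \<eta>p k (b - a) (\<lambda>t. y (t + a)) (\<lambda>t. w (t + a))"
    using t by (auto simp: resonant_wave_def zero_prod_def intro!: bexI[of _ "t - a"])
  with k show "k \<noteq> 0 \<and> (\<exists>y w. resonant_wave (n1\<^sup>2) (n2\<^sup>2) \<eta>m \<eta>p k (b - a) y w)" by blast
next
  assume "k \<noteq> 0 \<and> (\<exists>y w. resonant_wave (n1\<^sup>2) (n2\<^sup>2) \<eta>m \<eta>p k (b - a) y w)"
  then obtain y0 w0 where k: "k \<noteq> 0" and res: "resonant_wave (n1\<^sup>2) (n2\<^sup>2) \<eta>m \<eta>p k (b - a) y0 w0"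
    by blast
  have pq: "0 \<le> n1\<^sup>2" "n1\<^sup>2 \<le> n2\<^sup>2" using n by (auto intro: power_mono)
  define y w where "y t = y0 (t - a)" and "w t = w0 (t - a)" for t
  have wave: "wave (n1\<^sup>2) (n2\<^sup>2) k a b y w"
    using wave_affine[of "n1\<^sup>2" "n2\<^sup>2" k 1 a "-a" b y0 w0] res
    by (simp add: resonant_wave_def y_def[abs_def] w_def[abs_def])
  have yb: "y b \<noteq> 0" and ywa: "(y a, w a) \<noteq> 0"
    using resonant_wave_endpoints[OF res pq] by (simp_all add: y_def w_def)
  have left: "left_cond \<eta>m (y a) (w a)" and right: "w b = complex_of_real \<eta>p * y b"
    using res by (simp_all add: resonant_wave_def y_def w_def)
  have "y a \<noteq> 0" if "\<bar>\<eta>m\<bar> \<noteq> \<infinity>"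
    using that left ywa by (auto simp: left_cond_def zero_prod_def)
  then have bc: "boundary_cond \<eta>m k (y a) (\<i> * k * w a)" "boundary_cond (ereal \<eta>p) k (y b) (\<i> * k * w b)"
    using left right yb by (auto simp: boundary_cond_iff[OF k] left_cond_def)
  obtain \<epsilon> where \<epsilon>: "\<epsilon> \<in> admissible n1 n2 a b" "is_solution \<epsilon> k a b y (\<lambda>t. \<i> * k * w t)"
    using wave_imp_solution[OF wave n ab k] by blast
  have "\<exists>t\<in>{a<..<b}. y t \<noteq> 0"
  proof -
    have "continuous_on {a..b} y" using wave by (simp add: wave_def)
    then obtain d where d: "0 < d" "\<And>t. t \<in> {a..b} \<Longrightarrow> dist t b < d \<Longrightarrow> dist (y t) (y b) < norm (y b)"
      using yb ab unfolding continuous_on_iff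
      by (metis atLeastAtMost_iff less_imp_le order_refl zero_less_norm_iff)
    define t where "t = max ((a + b) / 2) (b - d / 2)"
    have "(a + b) / 2 \<le> t" "b - d / 2 \<le> t" "t < b" using ab d(1) by (simp_all add: t_def)
    then have "t \<in> {a<..<b}" "dist t b < d" using ab d(1) by (simp_all add: dist_real_def)
    then show ?thesis using d(2)[of t] by (intro bexI[of _ t]) auto
  qed
  then have "k \<in> resonances a b \<eta>m (ereal \<eta>p) \<epsilon>"
    unfolding resonances_def using k \<epsilon>(2) bc by blast
  then show "k \<in> achievable n1 n2 a b \<eta>m (ereal \<eta>p)"
    using \<epsilon>(1) by (auto simp: achievable_def)
qed

section \<open>The flux inequality\<close>

text \<open>The flux \<open>Re (w cnj y)\<close> has derivative \<open>- Im k (|w|\<^sup>2 + \<epsilon> |y|\<^sup>2)\<close> almost everywhere.\<close>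

lemma wave_flux_decreasing:
  assumes wave: "wave (n1\<^sup>2) (n2\<^sup>2) k a b y w" and n: "0 < n1" "n1 < n2" and ab: "a < b"
    and k: "k \<noteq> 0" "0 \<le> Im k"
  shows "Re (w b * cnj (y b)) \<le> Re (w a * cnj (y a))"
proof -
  have pq: "0 \<le> n1\<^sup>2" "n1\<^sup>2 \<le> n2\<^sup>2" using n by (auto intro: power_mono)
  obtain \<epsilon> where \<epsilon>: "\<epsilon> \<in> admissible n1 n2 a b" and sol: "is_solution \<epsilon> k a b y (\<lambda>t. \<i> * k * w t)"
    using wave_imp_solution[OF wave n ab k(1)] by blast
  have "AE t in lebesgue_on {a<..<b}. n1\<^sup>2 \<le> \<epsilon> t \<and> 
      ((\<lambda>t. \<i> * k * w t) has_vector_derivative - k\<^sup>2 * complex_of_real (\<epsilon> t) * y t) (at t)"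
    using \<epsilon> sol unfolding admissible_def is_solution_def by auto
  then have "AE t in lebesgue. t \<in> {a<..<b} \<longrightarrow> n1\<^sup>2 \<le> \<epsilon> t \<and>
      ((\<lambda>t. \<i> * k * w t) has_vector_derivative - k\<^sup>2 * complex_of_real (\<epsilon> t) * y t) (at t)"
    by (rule AE_restrict_space_iff[THEN iffD1, rotated]) simp
  then obtain N where N: "N \<in> null_sets lebesgue" and ode: "\<And>t. t \<in> {a<..<b} - N \<Longrightarrow> n1\<^sup>2 \<le> \<epsilon> t \<and>
      ((\<lambda>t. \<i> * k * w t) has_vector_derivative - k\<^sup>2 * complex_of_real (\<epsilon> t) * y t) (at t)"
    unfolding eventually_ae_filter by fastforce
  have cont: "continuous_on {a..b} y" "continuous_on {a..b} w" using wave by (auto simp: wave_def)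
  have "bounded ((\<lambda>t. norm (y t) + norm (w t)) ` {a..b})"
    using cont by (intro compact_imp_bounded compact_continuous_image continuous_intros) auto
  then obtain R where "\<And>t. t \<in> {a..b} \<Longrightarrow> norm (norm (y t) + norm (w t)) \<le> R"
    unfolding bounded_iff by blast
  then have R: "norm (y t) + norm (w t) \<le> R" if "t \<in> {a..b}" for t using that by fastforce
  have R': "norm (y t) \<le> R" "norm (w t) \<le> R" if "t \<in> {a..b}" for t
    using R[OF that] norm_ge_zero[of "y t"] norm_ge_zero[of "w t"] by linarith+
  have R0: "0 \<le> R" using R'(1)[of a] ab norm_ge_zero[of "y a"] by (metis atLeastAtMost_iff less_imp_le order_refl order_trans)
  define f where "f t = w t * cnj (y t)" for t
  define L where "L = n2\<^sup>2 * (norm k * R) * R + R * (norm k * R)"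
  have Lip: "norm (f t - f s) \<le> L * (t - s)" if st: "a \<le> s" "s \<le> t" "t \<le> b" for s t
  proof -
    have R_st: "norm (y \<tau>) + norm (w \<tau>) \<le> R" if "s \<le> \<tau>" "\<tau> \<le> t" for \<tau>
      using R that st by simp
    have "f t - f s = (w t - w s) * cnj (y t) + w s * cnj (y t - y s)"
      by (simp add: f_def algebra_simps)
    then have "norm (f t - f s) \<le> norm (w t - w s) * norm (y t) + norm (w s) * norm (y t - y s)"
      by (metis norm_triangle_ineq norm_mult complex_mod_cnj)
    also have "\<dots> \<le> (n2\<^sup>2 * (norm k * R) * (t - s)) * R + R * (norm k * R * (t - s))"
      using wave_increment_le[OF wave pq st R_st] R' st R0
      by (intro add_mono mult_mono) auto
    also have "\<dots> = L * (t - s)" by (simp add: L_def algebra_simps)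
    finally show ?thesis .
  qed
  have ac: "abs_cont_on {a..b} f"
  proof (rule Lipschitz_imp_abs_cont_on)
    fix s t assume "s \<in> {a..b}" "t \<in> {a..b}"
    then show "norm (f t - f s) \<le> L * \<bar>t - s\<bar>"
      using Lip[of s t] Lip[of t s] by (cases "s \<le> t") (auto simp: norm_minus_commute)
  qed
  have "Re (1 * (f b - f a)) \<le> 0 * (b - a)"
  proof (rule abs_cont_on_increment_le[OF ac])
    show "negligible N" using N by (simp add: negligible_iff_null_sets)
    fix x assume x: "x \<in> {a<..<b} - N"
    have "(y has_vector_derivative \<i> * k * w x) (at x within {a..b})"
      using sol x by (auto simp: is_solution_def)
    then have dy: "(y has_vector_derivative \<i> * k * w x) (at x)"
      using x by (simp add: at_within_Icc_at)
    have "((\<lambda>t. 1 / (\<i> * k) * (\<i> * k * w t)) has_vector_derivative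
        1 / (\<i> * k) * (- k\<^sup>2 * complex_of_real (\<epsilon> x) * y x)) (at x)"
      using ode[OF x] by (intro has_vector_derivative_mult_right) auto
    moreover have "1 / (\<i> * k) * (- k\<^sup>2 * complex_of_real (\<epsilon> x) * y x) = \<i> * k * complex_of_real (\<epsilon> x) * y x"
      using k by (simp add: field_simps power2_eq_square)
    ultimately have dw: "(w has_vector_derivative \<i> * k * complex_of_real (\<epsilon> x) * y x) (at x)"
      using k by simp
    have "(f has_vector_derivative w x * cnj (\<i> * k * w x) + \<i> * k * complex_of_real (\<epsilon> x) * y x * cnj (y x)) (at x)"
      unfolding f_def
      by (rule has_vector_derivative_mult[OF dw bounded_linear.has_vector_derivative[OF bounded_linear_cnj dy]])
    moreover have "Re (1 * (w x * cnj (\<i> * k * w x) + \<i> * k * complex_of_real (\<epsilon> x) * y x * cnj (y x)))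
        = - Im k * ((norm (w x))\<^sup>2 + \<epsilon> x * (norm (y x))\<^sup>2)"
      unfolding cmod_power2 by (simp add: algebra_simps power2_eq_square)
    moreover have "- Im k * ((norm (w x))\<^sup>2 + \<epsilon> x * (norm (y x))\<^sup>2) \<le> 0"
    proof -
      have "0 \<le> \<epsilon> x" using ode[OF x] pq by linarith
      then have "0 \<le> (norm (w x))\<^sup>2 + \<epsilon> x * (norm (y x))\<^sup>2" by simp
      then show ?thesis using k(2) by simp
    qed
    ultimately show "\<exists>D. (f has_vector_derivative D) (at x) \<and> Re (1 * D) \<le> 0" by metis
  qed (use ab in auto)
  then show ?thesis by (simp add: f_def)
qed

lemma resonant_wave_Im_neg:
  assumes res: "resonant_wave (n1\<^sup>2) (n2\<^sup>2) \<eta>m \<eta>p k L y w" and n: "0 < n1" "n1 < n2" and L: "0 < L"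
    and k: "k \<noteq> 0" and \<eta>: "\<bar>\<eta>m\<bar> = \<infinity> \<or> \<eta>m \<le> 0" "0 < \<eta>p"
  shows "Im k < 0"
proof (rule ccontr)
  assume "\<not> Im k < 0"
  have pq: "0 \<le> n1\<^sup>2" "n1\<^sup>2 \<le> n2\<^sup>2" using n by (auto intro: power_mono)
  have sq: "Re (complex_of_real c * u * cnj u) = c * (norm u)\<^sup>2" for c u
    unfolding cmod_power2 by (simp add: algebra_simps power2_eq_square)
  have "Re (w L * cnj (y L)) \<le> Re (w 0 * cnj (y 0))"
    using wave_flux_decreasing[of n1 n2 k 0 L y w] res n L k \<open>\<not> Im k < 0\<close>
    by (simp add: resonant_wave_def)
  also have "\<dots> \<le> 0"
  proof (cases "\<bar>\<eta>m\<bar> = \<infinity>")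
    case True
    then show ?thesis using res by (simp add: resonant_wave_def left_cond_def)
  next
    case False
    then have "real_of_ereal \<eta>m \<le> 0" using \<eta>(1) by (cases \<eta>m) auto
    moreover have "w 0 = complex_of_real (real_of_ereal \<eta>m) * y 0"
      using res False by (simp add: resonant_wave_def left_cond_def)
    ultimately show ?thesis by (simp only: sq) (simp add: mult_nonpos_nonneg)
  qed
  finally have "\<eta>p * (norm (y L))\<^sup>2 \<le> 0"
    using res by (simp add: resonant_wave_def sq del: times_complex.simps complex_cnj)
  moreover have "0 < \<eta>p * (norm (y L))\<^sup>2"
    using \<eta>(2) resonant_wave_endpoints(1)[OF res pq] by simp
  ultimately show False by simp
qed

section \<open>Closure under enlargement\<close>

text \<open>Run the given wave at speed \<open>c\<close>, so that it ends at time \<open>L / c\<close>, and continue it by the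
constant coefficient \<open>\<eta>p\<^sup>2\<close>, for which the line \<open>w = \<eta>p y\<close> is invariant.\<close>

lemma resonant_wave_enlarge:
  assumes res: "resonant_wave p q \<eta>m \<eta>p k L y w" and L: "0 < L" and c: "1 \<le> c"
    and \<eta>p: "p \<le> \<eta>p\<^sup>2" "\<eta>p\<^sup>2 \<le> q" "\<eta>p \<noteq> 0"
  shows "\<exists>y' w'. resonant_wave p q \<eta>m \<eta>p (complex_of_real c * k) L y' w'"
proof -
  define T where "T = L / c"
  have T: "0 < T" "T \<le> L" "c * T = L" using L c by (auto simp: T_def field_simps)
  let ?k = "complex_of_real c * k"
  have 1: "wave p q ?k 0 T (\<lambda>t. y (c * t)) (\<lambda>t. w (c * t))"
    using wave_affine[of p q k c 0 0 T y w] res T c by (simp add: resonant_wave_def)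
  define e where "e t = exp (\<i> * ?k * complex_of_real \<eta>p * complex_of_real t)" for t
  \<comment> \<open>The amplitude for which the continuation joins the given wave at time
      \<open>T\<close>.\<close>
  define P where "P = 2 * complex_of_real \<eta>p * y L / e T"
  have 2: "wave p q ?k T L (\<lambda>t. P * e t / (2 * complex_of_real \<eta>p)) (\<lambda>t. P * e t / 2)"
    using wave_constant_coefficient[OF \<eta>p e_def, of T L P 0] by simp
  define y' w' where "y' t = (if t \<le> T then y (c * t) else P * e t / (2 * complex_of_real \<eta>p))"
    and "w' t = (if t \<le> T then w (c * t) else P * e t / 2)" for t
  have eT: "e T \<noteq> 0" by (simp add: e_def)
  have right: "w L = complex_of_real \<eta>p * y L" using res by (simp add: resonant_wave_def)
  have wave: "wave p q ?k 0 L y' w'"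
    unfolding y'_def[abs_def] w'_def[abs_def]
    by (rule wave_concat[OF 1 2]) (use T \<eta>p eT right in \<open>auto simp: P_def\<close>)
  obtain t where t: "t \<in> {0..L}" "(y t, w t) \<noteq> 0" using res by (auto simp: resonant_wave_def)
  have "t / c \<in> {0..T}" "c * (t / c) = t" using t c by (auto simp: T_def divide_right_mono)
  then have "\<exists>t\<in>{0..L}. (y' t, w' t) \<noteq> 0"
    using t T by (intro bexI[of _ "t / c"]) (auto simp: y'_def w'_def)
  moreover have "w' L = complex_of_real \<eta>p * y' L"
    using T \<eta>p right by (cases "L = T") (auto simp: y'_def w'_def)
  moreover have "left_cond \<eta>m (y' 0) (w' 0)"
    using res T by (simp add: y'_def w'_def resonant_wave_def)
  ultimately show ?thesis using wave unfolding resonant_wave_def by blast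
qed

section \<open>Closure under limits\<close>

lemma resonant_wave_normalized:
  assumes res: "resonant_wave p q \<eta>m \<eta>p k L y w" and L: "0 < L"
  shows "\<exists>y' w'. resonant_wave p q \<eta>m \<eta>p k L y' w' \<and> (\<forall>t\<in>{0..L}. norm (y' t, w' t) \<le> 1) \<and>
    (\<exists>t\<in>{0..L}. norm (y' t, w' t) = 1)"
proof -
  have "continuous_on {0..L} (\<lambda>t. norm (y t, w t))"
    using res by (auto simp: resonant_wave_def wave_def intro!: continuous_intros)
  then obtain x where x: "x \<in> {0..L}" "\<And>t. t \<in> {0..L} \<Longrightarrow> norm (y t, w t) \<le> norm (y x, w x)"
    using continuous_attains_sup[of "{0..L}" "\<lambda>t. norm (y t, w t)"] L by auto
  define m where "m = norm (y x, w x)"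
  obtain t0 where "t0 \<in> {0..L}" "(y t0, w t0) \<noteq> 0" using res by (auto simp: resonant_wave_def)
  then have m: "0 < m" using x(2)[of t0] unfolding m_def by (metis less_le_trans zero_less_norm_iff)
  define l where "l = complex_of_real (1 / m)"
  have nl: "norm (l * y t, l * w t) = norm (y t, w t) / m" for t
  proof -
    have "(l * y t, l * w t) = (1 / m) *\<^sub>R (y t, w t)"
      by (simp add: l_def scaleR_conv_of_real)
    then have "norm (l * y t, l * w t) = norm ((1 / m) *\<^sub>R (y t, w t))" by (simp only:)
    then show ?thesis using m unfolding norm_scaleR by simp
  qed
  have l: "l \<noteq> 0" using m by (simp add: l_def)
  have "resonant_wave p q \<eta>m \<eta>p k L (\<lambda>t. l * y t) (\<lambda>t. l * w t)"
    using res wave_scale[of p q k 0 L y w l] l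
    by (auto simp: resonant_wave_def left_cond_def zero_prod_def mult.left_commute)
  moreover have "\<forall>t\<in>{0..L}. norm (l * y t, l * w t) \<le> 1"
    unfolding nl using x(2) m by (simp add: m_def)
  moreover have "norm (l * y x, l * w x) = 1" unfolding nl using m by (simp add: m_def)
  ultimately show ?thesis using x(1) by blast
qed

lemma uniform_limit_seq_mult:
  fixes c :: "nat \<Rightarrow> complex" and f :: "nat \<Rightarrow> real \<Rightarrow> complex"
  assumes "c \<longlonglongrightarrow> l" "uniform_limit X f g sequentially" "bounded (g ` X)"
  shows "uniform_limit X (\<lambda>n t. c n * f n t) (\<lambda>t. l * g t) sequentially"
proof (rule uniform_lim_mult)
  show "uniform_limit X (\<lambda>n t. c n) (\<lambda>t. l) sequentially"
    using assms(1) by (auto simp: uniform_limit_iff tendsto_iff)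
qed (use assms in \<open>auto simp: image_constant_conv\<close>)

text \<open>Waves normalized to have maximum 1 are bounded and equi-Lipschitz, so a subsequence converges
uniformly. The maximum norm is preserved, so the limit is nontrivial, and every defining condition
passes to the limit.\<close>

lemma resonant_wave_limit:
  assumes res: "\<And>n. \<exists>y w. resonant_wave p q \<eta>m \<eta>p (k n) L y w" and k: "k \<longlonglongrightarrow> l"
    and pq: "0 \<le> p" "p \<le> q" and L: "0 < L"
  shows "\<exists>y w. resonant_wave p q \<eta>m \<eta>p l L y w"
proof -
  have "\<forall>n. \<exists>y w. resonant_wave p q \<eta>m \<eta>p (k n) L y w \<and> (\<forall>t\<in>{0..L}. norm (y t, w t) \<le> 1) \<and>
    (\<exists>t\<in>{0..L}. norm (y t, w t) = 1)"
    using res resonant_wave_normalized[OF _ L] by meson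
  then obtain Y W where YW: "\<And>n. resonant_wave p q \<eta>m \<eta>p (k n) L (Y n) (W n)"
    and le1: "\<And>n t. t \<in> {0..L} \<Longrightarrow> norm (Y n t, W n t) \<le> 1"
    and eq1: "\<And>n. \<exists>t\<in>{0..L}. norm (Y n t, W n t) = 1"
    by metis
  have waves: "wave p q (k n) 0 L (Y n) (W n)" for n using YW by (simp add: resonant_wave_def)
  obtain B where B: "\<And>n. norm (k n) \<le> B"
    using convergent_imp_bounded[OF k] unfolding bounded_iff by blast
  have B0: "0 \<le> B" using B[of 0] norm_ge_zero order_trans by blast
  define C where "C = 2 * B + q * (2 * B)"
  have C: "0 \<le> C" using B0 pq by (simp add: C_def)
  have Lip: "norm ((Y n t, W n t) - (Y n s, W n s)) \<le> C * (t - s)" if st: "0 \<le> s" "s \<le> t" "t \<le> L" for n s t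
  proof -
    have 2: "norm (Y n \<tau>) + norm (W n \<tau>) \<le> 2" if "s \<le> \<tau>" "\<tau> \<le> t" for \<tau>
      using le1[of \<tau> n] norm_fst_le[of "Y n \<tau>" "W n \<tau>"] norm_snd_le[of "W n \<tau>" "Y n \<tau>"] that st by simp
    have "norm ((Y n t, W n t) - (Y n s, W n s)) \<le> norm (Y n t - Y n s) + norm (W n t - W n s)"
      using norm_Pair_le[of "Y n t - Y n s" "W n t - W n s"] by simp
    also have "\<dots> \<le> norm (k n) * 2 * (t - s) + q * (norm (k n) * 2) * (t - s)"
      using wave_increment_le[OF waves[of n] pq st 2] by (intro add_mono) auto
    also have "\<dots> \<le> B * 2 * (t - s) + q * (B * 2) * (t - s)"
      using B[of n] pq st by (intro add_mono mult_right_mono mult_left_mono) auto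
    also have "\<dots> = C * (t - s)" by (simp add: C_def algebra_simps)
    finally show ?thesis .
  qed
  define F where "F n t = (Y n t, W n t)" for n t
  have FLip: "norm (F n s - F n t) \<le> C * \<bar>s - t\<bar>" if "s \<in> {0..L}" "t \<in> {0..L}" for n s t
    using Lip[of s t n] Lip[of t s n] that norm_minus_commute[of "F n s" "F n t"]
    by (cases "s \<le> t") (auto simp: F_def)
  obtain g \<phi> where g: "continuous_on {0..L} g" and \<phi>: "strict_mono (\<phi> :: nat \<Rightarrow> nat)"
    and lim: "\<And>e. 0 < e \<Longrightarrow> \<exists>N. \<forall>n x. n \<ge> N \<and> x \<in> {0..L} \<longrightarrow> norm (F (\<phi> n) x - g x) < e"
  proof (rule Arzela_Ascoli[of "{0..L}" F 1])
    show "\<exists>d>0. \<forall>n t. t \<in> {0..L} \<and> norm (s - t) < d \<longrightarrow> norm (F n s - F n t) < e"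
      if s: "s \<in> {0..L}" and e: "0 < e" for s e
    proof (intro exI[of _ "e / (C + 1)"] conjI allI impI)
      show "0 < e / (C + 1)" using C e by simp
      fix n t assume t: "t \<in> {0..L} \<and> norm (s - t) < e / (C + 1)"
      have "norm (F n s - F n t) \<le> C * \<bar>s - t\<bar>" using FLip s t by blast
      also have "\<dots> \<le> (C + 1) * \<bar>s - t\<bar>" by (intro mult_right_mono) auto
      also have "\<dots> < e" using t C by (simp add: field_simps)
      finally show "norm (F n s - F n t) < e" .
    qed
  qed (use le1 in \<open>auto simp: F_def\<close>)
  define y w where "y t = fst (g t)" and "w t = snd (g t)" for t
  have gyw: "g t = (y t, w t)" for t by (simp add: y_def w_def)
  have uF: "uniform_limit {0..L} (\<lambda>n. F (\<phi> n)) g sequentially"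
    unfolding uniform_limit_iff eventually_sequentially dist_norm using lim by blast
  have uY: "uniform_limit {0..L} (\<lambda>n. Y (\<phi> n)) y sequentially"
    using bounded_linear.uniform_limit[OF bounded_linear_fst uF]
    by (simp add: F_def y_def[abs_def])
  have uW: "uniform_limit {0..L} (\<lambda>n. W (\<phi> n)) w sequentially"
    using bounded_linear.uniform_limit[OF bounded_linear_snd uF]
    by (simp add: F_def w_def[abs_def])
  have contyw: "continuous_on {0..L} y" "continuous_on {0..L} w"
    unfolding y_def w_def using g by (auto intro!: continuous_intros)
  have bd: "bounded (y ` {0..L})" "bounded (w ` {0..L})"
    using contyw by (auto intro!: compact_imp_bounded compact_continuous_image)
  have k\<phi>: "(\<lambda>n. \<i> * k (\<phi> n)) \<longlonglongrightarrow> \<i> * l"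
    using LIMSEQ_subseq_LIMSEQ[OF k \<phi>] by (intro tendsto_intros) (simp add: o_def)
  have "slope_incl 1 1 (\<lambda>t. \<i> * l * w t) y 0 L"
    by (rule slope_incl_limit[OF _ _ uniform_limit_seq_mult[OF k\<phi> uW bd(2)]])
      (use waves tendsto_uniform_limitI[OF uY] in \<open>auto simp: wave_def\<close>)
  moreover have "slope_incl p q (\<lambda>t. \<i> * l * y t) w 0 L"
    by (rule slope_incl_limit[OF _ _ uniform_limit_seq_mult[OF k\<phi> uY bd(1)]])
      (use waves tendsto_uniform_limitI[OF uW] pq in \<open>auto simp: wave_def\<close>)
  ultimately have wave: "wave p q l 0 L y w" using contyw by (simp add: wave_def)
  have ends: "(\<lambda>n. Y (\<phi> n) t) \<longlonglongrightarrow> y t" "(\<lambda>n. W (\<phi> n) t) \<longlonglongrightarrow> w t" if "t \<in> {0..L}" for t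
    using tendsto_uniform_limitI[OF uY that] tendsto_uniform_limitI[OF uW that] by auto
  have left: "left_cond \<eta>m (y 0) (w 0)"
  proof (cases "\<bar>\<eta>m\<bar> = \<infinity>")
    case True
    then have "Y n 0 = 0" for n using YW[of n] by (simp add: resonant_wave_def left_cond_def)
    then have "(\<lambda>n. 0) \<longlonglongrightarrow> y 0" using ends(1)[of 0] L by simp
    then show ?thesis using True by (simp add: left_cond_def LIMSEQ_const_iff)
  next
    case False
    then have W0: "W n 0 = complex_of_real (real_of_ereal \<eta>m) * Y n 0" for n
      using YW[of n] by (simp add: resonant_wave_def left_cond_def)
    have "(\<lambda>n. complex_of_real (real_of_ereal \<eta>m) * Y (\<phi> n) 0) \<longlonglongrightarrow> complex_of_real (real_of_ereal \<eta>m) * y 0"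
      using ends(1)[of 0] L by (intro tendsto_intros) auto
    then have "w 0 = complex_of_real (real_of_ereal \<eta>m) * y 0"
      using ends(2)[of 0] L unfolding W0 by (auto intro: LIMSEQ_unique)
    then show ?thesis using False by (simp add: left_cond_def)
  qed
  have WL: "W n L = complex_of_real \<eta>p * Y n L" for n using YW[of n] by (simp add: resonant_wave_def)
  have "(\<lambda>n. complex_of_real \<eta>p * Y (\<phi> n) L) \<longlonglongrightarrow> complex_of_real \<eta>p * y L"
    using ends(1)[of L] L by (intro tendsto_intros) auto
  then have right: "w L = complex_of_real \<eta>p * y L"
    using ends(2)[of L] L unfolding WL by (auto intro: LIMSEQ_unique)
  obtain N where N: "\<And>x. x \<in> {0..L} \<Longrightarrow> norm (F (\<phi> N) x - g x) < 1"
    using lim[of 1] by auto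
  obtain t where t: "t \<in> {0..L}" "norm (F (\<phi> N) t) = 1" using eq1[of "\<phi> N"] by (auto simp: F_def)
  have "g t \<noteq> 0" using N[OF t(1)] t(2) by auto
  then have "\<exists>t\<in>{0..L}. (y t, w t) \<noteq> 0" using t(1) gyw by metis
  then show ?thesis using wave left right unfolding resonant_wave_def by blast
qed

text \<open>For \<open>k = 0\<close> the state is constant, so it lies on both boundary lines, which meet only in 0.\<close>

lemma not_resonant_wave_0:
  assumes res: "resonant_wave p q \<eta>m \<eta>p 0 L y w" and pq: "0 \<le> p" "p \<le> q" and L: "0 < L"
    and \<eta>: "\<bar>\<eta>m\<bar> = \<infinity> \<or> \<eta>m \<le> 0" "0 < \<eta>p"
  shows False
proof -
  have wave: "wave p q 0 0 L y w" using res by (simp add: resonant_wave_def)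
  have "norm (y L - y 0) \<le> 0" "norm (w L - w 0) \<le> 0"
    using slope_incl_norm_le[of 1 1 "\<lambda>t. \<i> * 0 * w t" y 0 L 0 L 0]
      slope_incl_norm_le[of p q "\<lambda>t. \<i> * 0 * y t" w 0 L 0 L 0] wave pq L
    by (auto simp: wave_def)
  then have const: "y L = y 0" "w L = w 0" by auto
  have right: "w 0 = complex_of_real \<eta>p * y 0" using res const by (simp add: resonant_wave_def)
  have "y 0 = 0"
  proof (cases "\<bar>\<eta>m\<bar> = \<infinity>")
    case True
    then show ?thesis using res by (simp add: resonant_wave_def left_cond_def)
  next
    case False
    then have "real_of_ereal \<eta>m \<le> 0" using \<eta>(1) by (cases \<eta>m) auto
    moreover have "w 0 = complex_of_real (real_of_ereal \<eta>m) * y 0"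
      using res False by (simp add: resonant_wave_def left_cond_def)
    ultimately show ?thesis using right \<eta>(2) by (metis mult_cancel_right of_real_eq_iff not_le)
  qed
  then show False using resonant_wave_endpoints(1)[OF res pq] const by simp
qed

section \<open>Steering along a ray\<close>

definition steers ::
  "real \<Rightarrow> real \<Rightarrow> complex \<Rightarrow> real \<Rightarrow> complex \<Rightarrow> complex \<Rightarrow> complex \<Rightarrow> complex \<Rightarrow> bool" where
  "steers p q k T u w u' w' \<longleftrightarrow>
     (\<exists>y v. wave p q k 0 T y v \<and> y 0 = u \<and> v 0 = w \<and> y T = u' \<and> v T = w')"

lemma steers_scale:
  assumes "steers p q k T u w u' w'"
  shows "steers p q k T (l * u) (l * w) (l * u') (l * w')"
proof -
  obtain y v where "wave p q k 0 T y v" "y 0 = u" "v 0 = w" "y T = u'" "v T = w'"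
    using assms by (auto simp: steers_def)
  then show ?thesis
    unfolding steers_def using wave_scale[of p q k 0 T y v l] by blast
qed

lemma steers_trans:
  assumes 1: "steers p q k T u w u' w'" and 2: "steers p q k T' u' w' u'' w''"
    and T: "0 \<le> T" "0 < T'"
  shows "steers p q k (T + T') u w u'' w''"
proof -
  obtain y v where yv: "wave p q k 0 T y v" "y 0 = u" "v 0 = w" "y T = u'" "v T = w'"
    using 1 by (auto simp: steers_def)
  obtain y' v' where yv': "wave p q k 0 T' y' v'" "y' 0 = u'" "v' 0 = w'" "y' T' = u''" "v' T' = w''"
    using 2 by (auto simp: steers_def)
  have "wave p q k T (T + T') (\<lambda>t. y' (t - T)) (\<lambda>t. v' (t - T))"
    using wave_affine[of p q k 1 T "-T" "T + T'" y' v'] yv' by simp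
  from wave_concat[OF yv(1) this] show ?thesis
    unfolding steers_def using yv yv' T
    by (intro exI[of _ "\<lambda>t. if t \<le> T then y t else y' (t - T)"]
        exI[of _ "\<lambda>t. if t \<le> T then v t else v' (t - T)"]) auto
qed

text \<open>The time is a multiple of the one in which the argument of \<open>exp (- 2 \<i> k t)\<close> changes by \<open>\<pi>\<close>; the
absolute value accounts for the direction of rotation.\<close>

lemma exp_half_turns:
  fixes j :: nat
  assumes "Re k \<noteq> 0"
  shows "exp (- (2 * \<i> * k * complex_of_real (real j * pi / (2 * \<bar>Re k\<bar>))))
    = complex_of_real ((- exp (pi * Im k / \<bar>Re k\<bar>)) ^ j)"
proof -
  have "exp (- (2 * \<i> * k * complex_of_real (pi / (2 * \<bar>Re k\<bar>))))
      = complex_of_real (- exp (pi * Im k / \<bar>Re k\<bar>))"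
  proof -
    have "Re (- (2 * \<i> * k * complex_of_real (pi / (2 * \<bar>Re k\<bar>)))) = pi * Im k / \<bar>Re k\<bar>"
      by (simp add: field_simps)
    moreover have "Im (- (2 * \<i> * k * complex_of_real (pi / (2 * \<bar>Re k\<bar>)))) = - (pi * sgn (Re k))"
      using assms by (simp add: field_simps sgn_if abs_if)
    moreover have "cis (- (pi * sgn (Re k))) = -1"
      using assms by (auto simp: sgn_if complex_eq_iff)
    ultimately show ?thesis by (simp add: exp_eq_polar)
  qed
  moreover have "exp (- (2 * \<i> * k * complex_of_real (real j * pi / (2 * \<bar>Re k\<bar>))))
      = exp (- (2 * \<i> * k * complex_of_real (pi / (2 * \<bar>Re k\<bar>)))) ^ j"
    by (subst exp_of_nat_mult[symmetric]) (simp add: mult_ac)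
  ultimately show ?thesis by simp
qed

text \<open>The duration is inversely proportional to \<open>n\<close>, so the factor \<open>r\<close> is the same for all \<open>n\<close>. The
boundary conditions concern only the ratio of the two components, so it suffices to know the final
state up to the nonzero scalar \<open>l\<close>.\<close>

lemma steers_half_turns:
  fixes u w :: real and j :: nat
  assumes n: "p \<le> n\<^sup>2" "n\<^sup>2 \<le> q" "0 < n" and k: "Re k \<noteq> 0"
  defines "r \<equiv> (- exp (pi * Im k / \<bar>Re k\<bar>)) ^ j"
  shows "\<exists>l. l \<noteq> 0 \<and> steers p q k (real j * pi / (2 * \<bar>Re k\<bar> * n)) (complex_of_real u) (complex_of_real w)
    (l * complex_of_real (((w + n * u) - r * (w - n * u)) / (2 * n)))
    (l * complex_of_real (((w + n * u) + r * (w - n * u)) / 2))"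
proof -
  define T where "T = real j * pi / (2 * \<bar>Re k\<bar> * n)"
  define e where "e t = exp (\<i> * k * complex_of_real n * complex_of_real t)" for t
  define P M where "P = w + n * u" and "M = w - n * u"
  have wave: "wave p q k 0 T
      (\<lambda>t. (complex_of_real P * e t - complex_of_real M / e t) / (2 * complex_of_real n))
      (\<lambda>t. (complex_of_real P * e t + complex_of_real M / e t) / 2)"
    using n(3) by (intro wave_constant_coefficient[OF n(1,2) _ e_def]) auto
  have e0: "e 0 = 1" by (simp add: e_def)
  have eT: "e T \<noteq> 0" by (simp add: e_def)
  have nT: "complex_of_real n * complex_of_real T = complex_of_real (real j * pi / (2 * \<bar>Re k\<bar>))"
    using n(3) by (simp add: T_def)
  have "1 / (e T * e T) = exp (- (2 * \<i> * k * (complex_of_real n * complex_of_real T)))"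
    unfolding e_def by (simp add: exp_minus field_simps flip: exp_add exp_double)
  also have "\<dots> = complex_of_real r"
    unfolding nT r_def by (rule exp_half_turns[OF k])
  finally have r: "1 / e T = e T * complex_of_real r"
    using eT by (simp add: field_simps)
  have Mr: "complex_of_real M / e T = e T * complex_of_real (r * M)"
    using r by (simp add: divide_inverse mult_ac)
  have "steers p q k T (complex_of_real u) (complex_of_real w)
      (e T * complex_of_real ((P - r * M) / (2 * n))) (e T * complex_of_real ((P + r * M) / 2))"
    unfolding steers_def
  proof (intro exI conjI)
    show "(complex_of_real P * e 0 - complex_of_real M / e 0) / (2 * complex_of_real n) = complex_of_real u"
      "(complex_of_real P * e 0 + complex_of_real M / e 0) / 2 = complex_of_real w"
      using n(3) by (simp_all add: e0 P_def M_def)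
    show "(complex_of_real P * e T - complex_of_real M / e T) / (2 * complex_of_real n)
        = e T * complex_of_real ((P - r * M) / (2 * n))"
      "(complex_of_real P * e T + complex_of_real M / e T) / 2 = e T * complex_of_real ((P + r * M) / 2)"
      unfolding Mr by (simp_all add: field_simps)
  qed (rule wave)
  then show ?thesis
    using eT unfolding T_def P_def M_def by blast
qed

text \<open>Unless \<open>w + n u\<close> vanishes, it dominates \<open>w - n u\<close> after sufficiently many half turns, and then
the two components of the state have the same sign. This brings
a real initial state to a positive ratio, away from the ratios \<open>-n\<close>, which are
stationary under the coefficient \<open>n\<^sup>2\<close>.\<close>

lemma reach_positive_ratio:
  fixes u w :: real
  assumes n: "p \<le> n\<^sup>2" "n\<^sup>2 \<le> q" "0 < n" and k: "Re k \<noteq> 0" "Im k < 0" and P: "w + n * u \<noteq> 0"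
  shows "\<exists>T l x. 0 < T \<and> l \<noteq> 0 \<and> 0 < x \<and>
    steers p q k T (complex_of_real u) (complex_of_real w) l (l * complex_of_real x)"
proof -
  define r0 where "r0 = exp (pi * Im k / \<bar>Re k\<bar>)"
  define P M where "P = w + n * u" and "M = w - n * u"
  have "pi * Im k / \<bar>Re k\<bar> < 0" using k by (simp add: divide_neg_pos mult_pos_neg)
  then have r0: "0 < r0" "r0 < 1" by (auto simp: r0_def)
  have "(\<lambda>j. r0 ^ Suc j * \<bar>M\<bar>) \<longlonglongrightarrow> 0 * \<bar>M\<bar>"
    using r0 by (intro tendsto_intros LIMSEQ_Suc LIMSEQ_power_zero) auto
  then have "\<forall>\<^sub>F j in sequentially. r0 ^ Suc j * \<bar>M\<bar> < \<bar>P\<bar>"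
    using P by (intro order_tendstoD(2)) (auto simp: P_def)
  then obtain j where j: "r0 ^ Suc j * \<bar>M\<bar> < \<bar>P\<bar>"
    by (auto simp: eventually_sequentially)
  define r where "r = (- r0) ^ Suc j"
  have "\<bar>r * M\<bar> < \<bar>P\<bar>" using j r0 by (simp add: r_def abs_mult power_abs)
  then have "0 < P + r * M \<and> 0 < P - r * M \<or> P + r * M < 0 \<and> P - r * M < 0" by linarith
  then have sgn: "0 < (P + r * M) / (P - r * M)" and ne: "P - r * M \<noteq> 0"
    by (auto simp: zero_less_divide_iff)
  define T where "T = real (Suc j) * pi / (2 * \<bar>Re k\<bar> * n)"
  obtain l where l: "l \<noteq> 0" and st: "steers p q k T (complex_of_real u) (complex_of_real w)
      (l * complex_of_real ((P - r * M) / (2 * n))) (l * complex_of_real ((P + r * M) / 2))"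
    using steers_half_turns[OF n k(1), of "Suc j" u w] unfolding T_def P_def M_def r_def r0_def by blast
  \<comment> \<open>The first component is absorbed into the scalar, so that the state becomes a
      multiple of \<open>(1, x)\<close>.\<close>
  define l' x where "l' = l * complex_of_real ((P - r * M) / (2 * n))"
    and "x = n * ((P + r * M) / (P - r * M))"
  have "l * complex_of_real ((P + r * M) / 2) = l' * complex_of_real x"
  proof -
    have "(P + r * M) / 2 = (P - r * M) / (2 * n) * x"
    proof -
      have "a / 2 = d / (2 * n) * (n * (a / d))" if "d \<noteq> 0" for a d
        using that n(3) by (simp add: field_simps)
      from this[OF ne] show ?thesis unfolding x_def .
    qed
    then show ?thesis unfolding l'_def by (simp only: mult.assoc of_real_mult)
  qed
  then have "steers p q k T (complex_of_real u) (complex_of_real w) l' (l' * complex_of_real x)"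
    using st unfolding l'_def by (simp only:)
  moreover have "l' \<noteq> 0"
  proof -
    have "(P - r * M) / (2 * n) \<noteq> 0" using ne n(3) by simp
    then show ?thesis using l unfolding l'_def by (metis mult_eq_0_iff of_real_eq_0_iff)
  qed
  moreover have "0 < x" unfolding x_def using n(3) sgn by (rule mult_pos_pos)
  moreover have "0 < T" using k n(3) by (simp add: T_def)
  ultimately show ?thesis by blast
qed

text \<open>The expression is the ratio reached from \<open>x\<close> after \<open>j\<close> half turns with coefficient \<open>n\<^sup>2\<close>. It tends to
\<open>n\<close> as \<open>j\<close> grows, and the sign of \<open>(- s) ^ j\<close> decides on which side of \<open>n\<close> it lies. For
\<open>t = n1\<close> or \<open>t = n2\<close> convergence alone would not suffice: the parity of \<open>j\<close> is chosen such that,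
seen from the other endpoint, the ratio for \<open>n = t\<close> does not fall short of \<open>t\<close>, and then the
intermediate value theorem applies between \<open>t\<close> and that endpoint. An interior \<open>t\<close> is treated
like \<open>n2\<close>.\<close>

lemma ratio_attained:
  fixes n1 n2 x s t :: real
  assumes n: "0 < n1" "n1 < n2" and x: "0 < x" and t: "t \<in> {n1..n2}" and s: "0 < s" "s < 1"
  shows "\<exists>n\<in>{n1..n2}. \<exists>j>0. n * (((x + n) + (- s) ^ j * (x - n)) / ((x + n) - (- s) ^ j * (x - n))) = t"
proof -
  define \<phi> where "\<phi> j n = n * (((x + n) + (- s) ^ j * (x - n)) / ((x + n) - (- s) ^ j * (x - n)))" for j n
  have small: "\<bar>(- s) ^ j * (x - n)\<bar> < x + n" if "0 < n" for j n
  proof -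
    have "\<bar>(- s) ^ j\<bar> \<le> 1" using s by (simp add: power_abs power_le_one)
    then have "\<bar>(- s) ^ j * (x - n)\<bar> \<le> 1 * \<bar>x - n\<bar>" unfolding abs_mult by (rule mult_right_mono) simp
    also have "\<dots> < x + n" using x that by (simp add: abs_if)
    finally show ?thesis .
  qed
  have pos: "0 < (x + n) - (- s) ^ j * (x - n)" if "0 < n" for j n
    using small[OF that, of j] by (simp add: abs_less_iff)
  have cont: "continuous_on {a..b} (\<phi> j)" if "0 < a" for a b j
  proof -
    have "(x + n) - (- s) ^ j * (x - n) \<noteq> 0" if "n \<in> {a..b}" for n
      using pos[of n j] that \<open>0 < a\<close> by auto
    then show ?thesis unfolding \<phi>_def by (intro continuous_intros) blast
  qed
  have lim: "(\<lambda>j. \<phi> (m j) n) \<longlonglongrightarrow> n" if "0 < n" "filterlim m at_top sequentially" for n and m :: "nat \<Rightarrow> nat"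
  proof -
    have "(\<lambda>j. (- s) ^ m j) \<longlonglongrightarrow> 0"
      using filterlim_compose[OF LIMSEQ_power_zero[of "-s"] that(2)] s by simp
    then have "(\<lambda>j. \<phi> (m j) n) \<longlonglongrightarrow> n * (((x + n) + 0 * (x - n)) / ((x + n) - 0 * (x - n)))"
      unfolding \<phi>_def using x that by (intro tendsto_intros) auto
    then show ?thesis using x that by simp
  qed
  have ge: "n \<le> \<phi> j n" if "0 < n" "0 \<le> (- s) ^ j * (x - n)" for n j
  proof -
    have "1 \<le> ((x + n) + (- s) ^ j * (x - n)) / ((x + n) - (- s) ^ j * (x - n))"
      using pos[OF that(1), of j] that(2) by (simp add: le_divide_eq)
    from mult_left_mono[OF this, of n] show ?thesis using that by (simp add: \<phi>_def)
  qed
  have le: "\<phi> j n \<le> n" if "0 < n" "(- s) ^ j * (x - n) \<le> 0" for n j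
  proof -
    have "((x + n) + (- s) ^ j * (x - n)) / ((x + n) - (- s) ^ j * (x - n)) \<le> 1"
      using pos[OF that(1), of j] that(2) by (simp add: divide_le_eq)
    from mult_left_mono[OF this, of n] show ?thesis using that by (simp add: \<phi>_def)
  qed
  \<comment> \<open>Depending on the sign of \<open>x - t\<close>, the even or the odd numbers of half
      turns move the ratio for \<open>n = t\<close> to the side of \<open>t\<close>
      selected by \<open>\<sigma>\<close>.\<close>
  have parity: "\<exists>m. filterlim m at_top sequentially \<and> (\<forall>j. 0 < m j) \<and> (\<forall>j. 0 \<le> \<sigma> * ((- s) ^ m j * (x - t)))"
    if "\<sigma> = 1 \<or> \<sigma> = -1" for \<sigma> :: real
  proof (cases "0 \<le> \<sigma> * (x - t)")
    case True
    have "0 \<le> \<sigma> * ((- s) ^ (2 * Suc j) * (x - t))" for j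
    proof -
      have "\<sigma> * ((- s) ^ (2 * Suc j) * (x - t)) = ((- s) ^ (2 * Suc j)) * (\<sigma> * (x - t))" by simp
      moreover have "0 \<le> (- s) ^ (2 * Suc j)" by (rule zero_le_even_power) simp
      ultimately show ?thesis using True by (simp only: mult_nonneg_nonneg)
    qed
    moreover have "filterlim (\<lambda>j. 2 * Suc j) at_top sequentially"
      by (intro filterlim_subseq) (auto simp: strict_mono_def)
    moreover have "0 < 2 * Suc j" for j by simp
    ultimately show ?thesis by (intro exI[of _ "\<lambda>j. 2 * Suc j"] conjI allI)
  next
    case False
    have "0 \<le> \<sigma> * ((- s) ^ Suc (2 * j) * (x - t))" for j
    proof -
      have "\<sigma> * ((- s) ^ Suc (2 * j) * (x - t)) = ((- s) ^ Suc (2 * j)) * (\<sigma> * (x - t))" by simp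
      moreover have "(- s) ^ Suc (2 * j) \<le> 0" using s by (simp add: power_mult)
      moreover have "\<sigma> * (x - t) \<le> 0" using False by simp
      ultimately show ?thesis by (simp only: mult_nonpos_nonpos)
    qed
    moreover have "filterlim (\<lambda>j. Suc (2 * j)) at_top sequentially"
      by (intro filterlim_subseq) (auto simp: strict_mono_def)
    moreover have "0 < Suc (2 * j)" for j by simp
    ultimately show ?thesis by (intro exI[of _ "\<lambda>j. Suc (2 * j)"] conjI allI)
  qed
  have t0: "0 < t" using t n by simp
  have "\<exists>n\<in>{n1..n2}. \<exists>j>0. \<phi> j n = t"
  proof (cases "t = n1")
    case False
    obtain m where m: "filterlim m at_top sequentially" "\<And>j. 0 < m j" "\<And>j. 0 \<le> (- s) ^ m j * (x - t)"
      using parity[of 1] by auto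
    have "\<forall>\<^sub>F j in sequentially. \<phi> (m j) n1 < t"
      using lim[OF n(1) m(1)] t False by (intro order_tendstoD(2)) auto
    then obtain j where j: "\<phi> (m j) n1 < t" by (auto simp: eventually_sequentially)
    obtain n where "n1 \<le> n" "n \<le> t" "\<phi> (m j) n = t"
      using IVT'[of "\<phi> (m j)" n1 t t, OF _ ge[OF t0 m(3)] _ cont[OF n(1)]] j t by auto
    then have "n \<in> {n1..n2}" "0 < m j" "\<phi> (m j) n = t" using m(2) t by auto
    then show ?thesis by blast
  next
    case True
    obtain m where m: "filterlim m at_top sequentially" "\<And>j. 0 < m j" "\<And>j. 0 \<le> - 1 * ((- s) ^ m j * (x - t))"
      using parity[of "-1"] by auto
    have "\<forall>\<^sub>F j in sequentially. t < \<phi> (m j) n2"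
      using lim[of n2, OF _ m(1)] n True by (intro order_tendstoD(1)) auto
    then obtain j where j: "t < \<phi> (m j) n2" by (auto simp: eventually_sequentially)
    have "\<phi> (m j) n1 \<le> t" using le[OF t0, of "m j"] m(3)[of j] True by simp
    then obtain n where "n1 \<le> n" "n \<le> n2" "\<phi> (m j) n = t"
      using IVT'[of "\<phi> (m j)" n1 t n2, OF _ _ _ cont[OF n(1)]] j n by auto
    then have "n \<in> {n1..n2}" "0 < m j" "\<phi> (m j) n = t" using m(2) by auto
    then show ?thesis by blast
  qed
  then show ?thesis by (simp add: \<phi>_def)
qed

lemma reach_right_end:
  assumes n: "0 < n1" "n1 < n2" and \<eta>p: "\<eta>p \<in> {n1..n2}" and k: "Re k \<noteq> 0" "Im k < 0" and x: "0 < x"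
  shows "\<exists>T l. 0 < T \<and> l \<noteq> 0 \<and>
    steers (n1\<^sup>2) (n2\<^sup>2) k T 1 (complex_of_real x) l (complex_of_real \<eta>p * l)"
proof -
  define s where "s = exp (pi * Im k / \<bar>Re k\<bar>)"
  have "pi * Im k / \<bar>Re k\<bar> < 0" using k by (simp add: divide_neg_pos mult_pos_neg)
  then have s: "0 < s" "s < 1" by (auto simp: s_def)
  obtain n j where nn: "n \<in> {n1..n2}" and j: "0 < j"
    and eq: "n * (((x + n) + (- s) ^ j * (x - n)) / ((x + n) - (- s) ^ j * (x - n))) = \<eta>p"
    using ratio_attained[OF n x \<eta>p s] by blast
  have n0: "0 < n" using nn n by simp
  have np: "n1\<^sup>2 \<le> n\<^sup>2" "n\<^sup>2 \<le> n2\<^sup>2" using nn n by (auto intro: power_mono)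
  define A B where "A = (x + n) + (- s) ^ j * (x - n)" and "B = (x + n) - (- s) ^ j * (x - n)"
  have B: "B \<noteq> 0" using eq \<eta>p n by (auto simp: B_def)
  define T where "T = real j * pi / (2 * \<bar>Re k\<bar> * n)"
  obtain l where l: "l \<noteq> 0" and st: "steers (n1\<^sup>2) (n2\<^sup>2) k T (complex_of_real 1) (complex_of_real x)
      (l * complex_of_real (B / (2 * n))) (l * complex_of_real (A / 2))"
    using steers_half_turns[OF np n0 k(1), of j 1 x] unfolding T_def A_def B_def s_def by auto
  have "A / 2 = \<eta>p * (B / (2 * n))"
    using eq B n0 unfolding A_def[symmetric] B_def[symmetric] by (simp add: field_simps)
  then have "l * complex_of_real (A / 2) = complex_of_real \<eta>p * (l * complex_of_real (B / (2 * n)))"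
    by (simp only: of_real_mult mult.left_commute)
  moreover have "l * complex_of_real (B / (2 * n)) \<noteq> 0" using l B n0 by simp
  moreover have "0 < T" using j k n0 by (simp add: T_def)
  ultimately show ?thesis using st by (metis of_real_1)
qed

text \<open>At most one \<open>n\<close> makes \<open>w + n u\<close> vanish at the initial state, so one of \<open>n1\<close>, \<open>n2\<close> can serve in the
first stage. The scalar \<open>c\<close> converts the total duration into the length \<open>L\<close>.\<close>

lemma resonant_wave_exists:
  assumes n: "0 < n1" "n1 < n2" and L: "0 < L" and \<eta>p: "\<eta>p \<in> {n1..n2}"
    and \<kappa>: "Re \<kappa> \<noteq> 0" "Im \<kappa> < 0"
  shows "\<exists>c>0. \<exists>y w. resonant_wave (n1\<^sup>2) (n2\<^sup>2) \<eta>m \<eta>p (complex_of_real c * \<kappa>) L y w"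
proof -
  define u0 w0 :: real where "u0 = (if \<bar>\<eta>m\<bar> = \<infinity> then 0 else 1)"
    and "w0 = (if \<bar>\<eta>m\<bar> = \<infinity> then 1 else real_of_ereal \<eta>m)"
  have left: "left_cond \<eta>m (complex_of_real u0) (complex_of_real w0)"
    by (simp add: left_cond_def u0_def w0_def)
  have ne: "u0 \<noteq> 0 \<or> w0 \<noteq> 0" by (simp add: u0_def w0_def)
  have "\<exists>n. n1 \<le> n \<and> n \<le> n2 \<and> w0 + n * u0 \<noteq> 0"
  proof (rule ccontr)
    assume "\<not> ?thesis"
    then have "w0 + n1 * u0 = 0" "w0 + n2 * u0 = 0" using n by auto
    moreover have "(n2 - n1) * u0 = (w0 + n2 * u0) - (w0 + n1 * u0)" by (simp add: algebra_simps)
    ultimately have "(n2 - n1) * u0 = 0" by (simp only: diff_self)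
    then show False using ne n \<open>w0 + n1 * u0 = 0\<close> by simp
  qed
  then obtain n where nn: "n1 \<le> n" "n \<le> n2" "w0 + n * u0 \<noteq> 0" by blast
  have np: "n1\<^sup>2 \<le> n\<^sup>2" "n\<^sup>2 \<le> n2\<^sup>2" "0 < n" using nn n by (auto intro: power_mono)
  obtain T l x where T: "0 < T" and l: "l \<noteq> 0" and x: "0 < x"
    and 1: "steers (n1\<^sup>2) (n2\<^sup>2) \<kappa> T (complex_of_real u0) (complex_of_real w0) l (l * complex_of_real x)"
    using reach_positive_ratio[OF np \<kappa> nn(3)] by blast
  obtain T' l' where T': "0 < T'"
    and 2: "steers (n1\<^sup>2) (n2\<^sup>2) \<kappa> T' 1 (complex_of_real x) l' (complex_of_real \<eta>p * l')"
    using reach_right_end[OF n \<eta>p \<kappa> x] by blast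
  have 3: "steers (n1\<^sup>2) (n2\<^sup>2) \<kappa> T' l (l * complex_of_real x) (l * l') (l * (complex_of_real \<eta>p * l'))"
    using steers_scale[OF 2, of l] by simp
  have "0 \<le> T" using T by simp
  from steers_trans[OF 1 3 this T'] obtain y w where wave: "wave (n1\<^sup>2) (n2\<^sup>2) \<kappa> 0 (T + T') y w"
    and yw: "y 0 = complex_of_real u0" "w 0 = complex_of_real w0"
      "y (T + T') = l * l'" "w (T + T') = l * (complex_of_real \<eta>p * l')"
    unfolding steers_def by blast
  define c where "c = (T + T') / L"
  have c: "0 < c" "c * L = T + T'" using T T' L by (auto simp: c_def)
  have "wave (n1\<^sup>2) (n2\<^sup>2) (complex_of_real c * \<kappa>) 0 L (\<lambda>t. y (c * t)) (\<lambda>t. w (c * t))"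
    using wave_affine[of "n1\<^sup>2" "n2\<^sup>2" \<kappa> c 0 0 L y w] wave c by simp
  then have "resonant_wave (n1\<^sup>2) (n2\<^sup>2) \<eta>m \<eta>p (complex_of_real c * \<kappa>) L (\<lambda>t. y (c * t)) (\<lambda>t. w (c * t))"
    using left yw ne L c(2) by (auto simp: resonant_wave_def zero_prod_def intro!: bexI[of _ 0])
  then show ?thesis using c(1) by blast
qed

section \<open>Sets that are unions of closed rays\<close>

text \<open>The moduli on a nonempty ray form a closed set that is bounded below.\<close>

lemma rho_min_attained:
  assumes closed: "closed S" and S0: "0 \<notin> S"
    and \<gamma>: "\<gamma> \<in> edom (rho_min S)"
  shows "\<exists>r. rho_min S \<gamma> = ereal r \<and> 0 < r \<and> complex_of_real r * cis \<gamma> \<in> S \<and> \<gamma> \<in> {-pi<..pi}"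
proof -
  define R where "R = {norm k | k. k \<in> S \<and> Arg k = \<gamma>}"
  have rho: "rho_min S \<gamma> = Inf (ereal ` R)"
    unfolding rho_min_def R_def by (rule arg_cong[where f = Inf]) auto
  have "R \<noteq> {}"
  proof
    assume "R = {}"
    then have "rho_min S \<gamma> = \<infinity>" unfolding rho by (simp add: top_ereal_def)
    then show False using \<gamma> by (simp add: edom_def)
  qed
  have bdd: "bdd_below R" by (auto simp: R_def intro!: bdd_belowI[of _ 0])
  have inS: "complex_of_real r * cis \<gamma> \<in> S" if "r \<in> R" for r
    using that by (auto simp: R_def) (metis rcis_cmod_Arg rcis_def)
  define r where "r = Inf R"
  have "rho_min S \<gamma> = ereal r"
    unfolding rho r_def using ereal_Inf'[OF bdd \<open>R \<noteq> {}\<close>] by simp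
  obtain f where f: "\<And>n. f n \<in> R" "f \<longlonglongrightarrow> r"
    using closure_contains_Inf[OF \<open>R \<noteq> {}\<close> bdd] unfolding r_def closure_sequential by blast
  have "(\<lambda>n. complex_of_real (f n) * cis \<gamma>) \<longlonglongrightarrow> complex_of_real r * cis \<gamma>"
    using f by (intro tendsto_intros)
  then have rS: "complex_of_real r * cis \<gamma> \<in> S"
    using closed_sequentially[OF closed, of "\<lambda>n. complex_of_real (f n) * cis \<gamma>"] inS f by blast
  have "0 \<le> r" unfolding r_def using \<open>R \<noteq> {}\<close> by (intro cInf_greatest) (auto simp: R_def)
  moreover have "r \<noteq> 0" using rS S0 by auto
  moreover have "\<gamma> \<in> {-pi<..pi}"
    using \<open>R \<noteq> {}\<close> Arg_bounded by (auto simp: R_def)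
  ultimately show ?thesis using \<open>rho_min S \<gamma> = ereal r\<close> rS by auto
qed

lemma norm_ge_rho_min: "k \<in> S \<Longrightarrow> rho_min S (Arg k) \<le> ereal (norm k)"
  unfolding rho_min_def by (rule Inf_lower) auto

lemma edom_rho_minI: "k \<in> S \<Longrightarrow> Arg k \<in> edom (rho_min S)"
  unfolding edom_def using norm_ge_rho_min[of k S] by (auto intro: le_less_trans)

lemma set_eq_rays_from_rho_min:
  assumes closed: "closed S" and S0: "0 \<notin> S"
    and enlarge: "\<And>c k. 1 \<le> c \<Longrightarrow> k \<in> S \<Longrightarrow> complex_of_real c * k \<in> S"
  shows "S = {complex_of_real c * cis \<gamma> * complex_of_real (real_of_ereal (rho_min S \<gamma>)) | c \<gamma>.
    1 \<le> c \<and> \<gamma> \<in> edom (rho_min S)}" (is "S = ?R")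
proof (intro equalityI subsetI)
  fix k assume k: "k \<in> S"
  obtain r where r: "rho_min S (Arg k) = ereal r" "0 < r"
    using rho_min_attained[OF closed S0 edom_rho_minI[OF k]] by blast
  have "r \<le> norm k" using norm_ge_rho_min[OF k] r by simp
  moreover have "k = complex_of_real (norm k / r) * cis (Arg k) * complex_of_real r"
    using r rcis_cmod_Arg[of k] by (simp add: rcis_def)
  ultimately show "k \<in> ?R"
    using r edom_rho_minI[OF k] by (intro CollectI exI[of _ "norm k / r"] exI[of _ "Arg k"]) auto
next
  fix k assume "k \<in> ?R"
  then obtain c \<gamma> where k: "k = complex_of_real c * cis \<gamma> * complex_of_real (real_of_ereal (rho_min S \<gamma>))"
    and c: "1 \<le> c" and \<gamma>: "\<gamma> \<in> edom (rho_min S)" by blast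
  obtain r where r: "rho_min S \<gamma> = ereal r" "complex_of_real r * cis \<gamma> \<in> S"
    using rho_min_attained[OF closed S0 \<gamma>] by blast
  have "k = complex_of_real c * (complex_of_real r * cis \<gamma>)" by (simp add: k r)
  then show "k \<in> S" using enlarge[OF c r(2)] by simp
qed

theorem theorem9p2:
  fixes n1 n2 sm sp \<eta>p :: real and \<eta>m :: ereal
  defines "S \<equiv> achievable n1 n2 sm sp \<eta>m (ereal \<eta>p)"
  assumes "0 < n1" and "n1 < n2"
    and "sm < sp"
    and "\<eta>m \<in> ereal ` {..<0} \<union> {0, \<infinity>}"
    and "\<eta>p \<in> {n1..n2}"
  shows "({- pi<..<0} - {- (pi / 2)} \<subseteq> edom (rho_min S) \<and> edom (rho_min S) \<subseteq> {- pi<..<0} \<and>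
          S = {complex_of_real c * cis \<gamma> * complex_of_real (real_of_ereal (rho_min S \<gamma>)) | c \<gamma>.
                 1 \<le> c \<and> \<gamma> \<in> edom (rho_min S)}) \<and>
         (pareto_Dr S = decay_graph (decay_from_frontier (pareto_mod S)) \<and>
          (\<forall>\<alpha>::real. beta_min S \<alpha> = decay_from_frontier (pareto_mod S) \<alpha>))"
proof -
  note n = assms(2,3)
  define L where "L = sp - sm"
  have L: "0 < L" using assms(4) by (simp add: L_def)
  have pq: "0 \<le> n1\<^sup>2" "n1\<^sup>2 \<le> n2\<^sup>2" using n by (auto intro: power_mono)
  have \<eta>m: "\<bar>\<eta>m\<bar> = \<infinity> \<or> \<eta>m \<le> 0" using assms(5) by auto
  have \<eta>p: "0 < \<eta>p" "n1\<^sup>2 \<le> \<eta>p\<^sup>2" "\<eta>p\<^sup>2 \<le> n2\<^sup>2" using assms(6) n by (auto intro: power_mono)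
  have S: "k \<in> S \<longleftrightarrow> k \<noteq> 0 \<and> (\<exists>y w. resonant_wave (n1\<^sup>2) (n2\<^sup>2) \<eta>m \<eta>p k L y w)" for k
    unfolding S_def L_def by (rule achievable_iff[OF n assms(4)])
  have S0: "0 \<notin> S" by (simp add: S)
  have lower: "Im k < 0" if "k \<in> S" for k
    using that resonant_wave_Im_neg[OF _ n L _ \<eta>m \<eta>p(1)] by (auto simp: S)
  have "l \<in> S" if k: "\<And>n. k n \<in> S" and lim: "k \<longlonglongrightarrow> l" for k l
  proof -
    have "\<exists>y w. resonant_wave (n1\<^sup>2) (n2\<^sup>2) \<eta>m \<eta>p l L y w"
      using k by (intro resonant_wave_limit[OF _ lim pq L]) (simp add: S)
    moreover from this have "l \<noteq> 0" using not_resonant_wave_0[OF _ pq L \<eta>m \<eta>p(1)] by blast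
    ultimately show ?thesis by (simp add: S)
  qed
  then have closed: "closed S" unfolding closed_sequential_limits by blast
  have enlarge: "complex_of_real c * k \<in> S" if "1 \<le> c" "k \<in> S" for c k
    using that resonant_wave_enlarge[OF _ L that(1) \<eta>p(2,3)] \<eta>p(1) by (auto simp: S)
  have rays: "\<gamma> \<in> edom (rho_min S)" if \<gamma>: "\<gamma> \<in> {- pi<..<0} - {- (pi / 2)}" for \<gamma>
  proof -
    have "sin \<gamma> < 0" using \<gamma> sin_gt_zero[of "-\<gamma>"] by simp
    moreover have "cos \<gamma> \<noteq> 0"
    proof
      assume "cos \<gamma> = 0"
      then have "cos (- \<gamma>) = cos (pi / 2)" by simp
      from cos_inj_pi[OF _ _ _ _ this] have "- \<gamma> = pi / 2" using \<gamma> by simp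
      then have "\<gamma> = - (pi / 2)" by linarith
      then show False using \<gamma> by blast
    qed
    ultimately obtain c where c: "0 < c"
        "\<exists>y w. resonant_wave (n1\<^sup>2) (n2\<^sup>2) \<eta>m \<eta>p (complex_of_real c * cis \<gamma>) L y w"
      using resonant_wave_exists[OF n L assms(6), of "cis \<gamma>" \<eta>m] by auto
    then have "complex_of_real c * cis \<gamma> \<in> S" by (simp add: S)
    moreover have "Arg (complex_of_real c * cis \<gamma>) = \<gamma>"
      using c(1) \<gamma> Arg_rcis[of \<gamma> c] by (simp add: rcis_def)
    ultimately show ?thesis using edom_rho_minI by metis
  qed
  have dom: "\<gamma> \<in> {- pi<..<0}" if \<gamma>: "\<gamma> \<in> edom (rho_min S)" for \<gamma>
  proof -
    obtain r where r: "0 < r" "complex_of_real r * cis \<gamma> \<in> S" "\<gamma> \<in> {-pi<..pi}"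
      using rho_min_attained[OF closed S0 \<gamma>] by blast
    then have "sin \<gamma> < 0" using lower[OF r(2)] by (simp add: mult_less_0_iff)
    then have "\<not> 0 \<le> \<gamma>" using sin_ge_zero[of \<gamma>] r(3) by auto
    then show ?thesis using r(3) by simp
  qed
  note rad = set_eq_rays_from_rho_min[OF closed S0 enlarge]
  have mem: "k \<in> S \<longleftrightarrow> (\<exists>c\<ge>1. \<exists>k'\<in>pareto_mod S. k = complex_of_real c * k')" for k
  proof -
    have "k \<in> S \<longleftrightarrow> (\<exists>c \<gamma>. k = complex_of_real c * cis \<gamma> * complex_of_real (real_of_ereal (rho_min S \<gamma>)) \<and>
        1 \<le> c \<and> \<gamma> \<in> edom (rho_min S))"
      using rad by blast
    also have "\<dots> \<longleftrightarrow> (\<exists>c\<ge>1. \<exists>k'\<in>pareto_mod S. k = complex_of_real c * k')"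
      unfolding pareto_mod_def by (auto simp: mult.assoc)
    finally show ?thesis .
  qed
  have beta: "beta_min S = decay_from_frontier (pareto_mod S)"
    by (rule ext) (simp only: beta_min_def decay_from_frontier_def mem)
  show ?thesis
  proof (intro conjI allI subsetI)
    show "pareto_Dr S = decay_graph (decay_from_frontier (pareto_mod S))"
      by (simp only: pareto_Dr_def beta)
    show "beta_min S \<alpha> = decay_from_frontier (pareto_mod S) \<alpha>" for \<alpha>
      by (simp only: beta)
  qed (rule rays dom rad; assumption?)+
qed

end
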